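(* Let $\lambda>-1/2$, $\lambda\ne0$, let $M_n^\lambda(s)=\int_0^1 C_n^\lambda(x)x^{s-1}(1-x^2)^{\lambda/2-3/4}dx$ and let $P_n^\lambda(s)$ be the polynomial defined by $M_n^\lambda(s)=\frac{\Gamma(\lambda/2+1/4)\Gamma((s+\varepsilon)/2)}{2(n!)\Gamma((s+n+\lambda)/2+1/4)}P_n^\lambda(s)$, where $\varepsilon=0$ for $n$ even and $\varepsilon=1$ for $n$ odd. For integers $n\ge0$ define (Gould S:4/1-type forms) \[ p_{2n}^\lambda(s)=n!(2n)!\sum_{r=0}^n\frac{(-1)^{n-r}2^{2r-1}\binom{n+r+\lambda-1}{n+r}\binom{n+r}{2r}\binom{\frac12(s-2)+r}{r}\binom{n+\frac12(s+\lambda)-\frac34}{n-r}}{\binom nr}, \] \[ p_{2n+1}^\lambda(s)=n!(2n+1)!\sum_{r=0}^n\frac{(-1)^{n-r}2^{2r}\binom{n+r+\lambda}{n+r+1}\binom{n+r+1}{2r+1}\binom{\frac12(s-1)+r}{r}\binom{n+\frac12(s+1+\lambda)-\frac34}{n-r}}{\binom nr}. \] (a) Each $p_n^\lambda(s)$ equals $P_n^\lambda(s)$ up to multiplication by a nonzero constant independent of $s$, and (Gould S:3/2-type forms) \[ p_{2n}^\lambda(s)=n!(2n)!\binom{n+\lambda-1}{n}\binom{n+\frac12(s+\lambda)-\frac34}{n}\sum_{r=0}^n\frac{(-1)^{n-r}2^{2r-1}\binom{n+r+\lambda-1}{r}\binom{n+r}{2r}\binom{\frac12(s-2)+r}{r}}{\binom{n+r}{r}\binom{\frac12(s+\lambda)-\frac34+r}{r}},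 \] \[ p_{2n+1}^\lambda(s)=n!(2n+1)!\binom{n+\lambda}{n+1}\binom{n+\frac12(s+\lambda)-\frac14}{n}\sum_{r=0}^n\frac{(-1)^{n-r}2^{2r}\binom{n+r+\lambda}{r}\binom{n+r+1}{2r+1}\binom{\frac12(s-1)+r}{r}}{\binom{n+r+1}{r}\binom{\frac12(s+\lambda)-\frac14+r}{r}}. \] For $\lambda=1$ these reduce to (Gould S:2/1-type forms) \[ p_{2n}^1(s)=n!(2n)!\binom{n+\frac s2-\frac14}{n}\sum_{r=0}^n\frac{(-1)^{n-r}2^{2r-1}\binom{n+r}{2r}\binom{\frac12(s-2)+r}{r}}{\binom{\frac s2-\frac14+r}{r}},\quad p_{2n+1}^1(s)=n!(2n+1)!\binom{n+\frac s2+\frac14}{n}\sum_{r=0}^n\frac{(-1)^{n-r}2^{2r}\binom{n+r+1}{2r+1}\binom{\frac12(s-1)+r}{r}}{\binom{\frac s2+\frac14+r}{r}}. \] (b) Define, for $n\ge1$, \[ q_{2n}^\lambda(s)=\frac{2n\binom{n+\lambda-1}{n}}{\lambda\binom{2n+2\lambda-1}{2n-1}}\sum_{r=0}^n\frac{(-1)^{n-r}2^{2r-1}\binom{n+r+\lambda-1}{r}\binom{n+r}{2r}\binom{\frac12(s-2)+r}{r}}{\binom{n+r}{r}\binom{\frac12(s+\lambda)-\frac34+r}{r}}, \] and for $n\ge0$, \[ q_{2n+1}^\lambda(s)=\frac{(2n+1)\binom{n+\lambda}{n+1}}{\lambda\binom{2n+2\lambda}{2n}}\sum_{r=0}^n\frac{(-1)^{n-r}2^{2r}\binom{n+r+\lambda}{r}\binom{n+r+1}{2r+1}\binom{\frac12(s-1)+r}{r}}{\binom{n+r+1}{r}\binom{\frac12(s+\lambda)-\frac14+r}{r}}.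 \] Then \[ q_{2n}^\lambda(s)=\frac{2p_{2n}^\lambda(s)}{\lambda(n-1)!(2n)!\binom{2n+2\lambda-1}{2n-1}\binom{n+\frac12(s+\lambda)-\frac34}{n}}=\frac{2^{2n+1}p_{2n}^\lambda(s)}{(2\lambda)_{2n}\prod_{j=1}^n(2s+2\lambda+4j-3)}, \] \[ q_{2n+1}^\lambda(s)=\frac{p_{2n+1}^\lambda(s)}{\lambda\,n!(2n)!\binom{2n+2\lambda}{2n}\binom{n+\frac12(s+\lambda)-\frac14}{n}}=\frac{2^{2n+1}p_{2n+1}^\lambda(s)}{(2\lambda)_{2n+1}\prod_{j=1}^n(2s+2\lambda+4j-1)}, \] and both the numerator and the denominator polynomials of the rational function $q_n^\lambda(s)$ have degree $\lfloor n/2\rfloor$. (c) For $\Re s>0$ the rational function $q_n^\lambda(s)$ has no singularities and has the same zeros on the critical line as $p_n^\lambda(s)$; in particular for real $t$ the roots of $p_n^\lambda(1/2+it)$ and $q_n^\lambda(1/2+it)$ coincide. For real $s>1$, $q_n^\lambda(s)\in(0,1)$, and $q_n^\lambda(s)\to1$ from below as $s\to\infty$ along the real axis. Moreover, with $\varepsilon=0$ for $n$ even and $\varepsilon=1$ for $n$ odd, \[ q_n^\lambda(s)=(-1)^{\lfloor n/2\rfloor}\binom{\lfloor n/2\rfloor+\frac{1-s+\lambda+\varepsilon}{2}-\frac34}{\lfloor n/2\rfloor}\binom{\lfloor n/2\rfloor+\frac{s+\lambda+\varepsilon}{2}-\frac34}{\lfloor n/2\rfloor}^{-1}q_n^\lambda(1-s).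 \]
   Context: $C_n^\lambda(x)=\sum_{r=0}^{\lfloor n/2\rfloor}(-1)^r\binom{n-r}{r}\binom{n-r-1+\lambda}{n-r}(2x)^{n-2r}$ are the Gegenbauer polynomials. For complex $x$ and integer $k\ge0$, $\binom xk=x(x-1)\cdots(x-k+1)/k!$; binomial coefficients with non-integer lower entry such as $\binom{2n+2\lambda-1}{2n-1}$ are read as $\Gamma(2n+2\lambda)/(\Gamma(2n)\Gamma(2\lambda+1))$, i.e. via Gamma functions. $(a)_m=\Gamma(a+m)/\Gamma(a)$ is the Pochhammer symbol.
   Formalization: The claims that q_n(s) lies in (0,1) for real s>1 and tends to 1 from below are stated for n≥2 only, since q_1(s)=1 identically; that identity is stated separately. *)

theory Defs
  imports "HOL-Analysis.Analysis" "HOL-Computational_Algebra.Polynomial_Factorial"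
begin

text \<open>Binomial coefficients with a nonnegative integer lower entry are rendered by \<open>gchoose\<close>;
  \<open>Gbinom\<close> is the reading via Gamma functions.\<close>

definition Gbinom :: "complex \<Rightarrow> complex \<Rightarrow> complex" where
  "Gbinom x y = Gamma (x + 1) / (Gamma (y + 1) * Gamma (x - y + 1))"

definition eps :: "nat \<Rightarrow> nat" where
  "eps n = (if even n then 0 else 1)"

definition gegenbauer :: "real \<Rightarrow> nat \<Rightarrow> real \<Rightarrow> real" where
  "gegenbauer lam n x =
     (\<Sum>r=0..n div 2. (-1)^r * real ((n - r) choose r)
        * ((real n - real r - 1 + lam) gchoose (n - r)) * (2 * x)^(n - 2 * r))"

definition mellinM :: "real \<Rightarrow> nat \<Rightarrow> complex \<Rightarrow> complex" where
  "mellinM lam n s =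
     (LINT x:{0..1}|lborel. of_real (gegenbauer lam n x) * of_real x powr (s - 1)
        * of_real ((1 - x\<^sup>2) powr (lam / 2 - 3 / 4)))"

text \<open>The integral converges for every \<open>n\<close> on the half-plane \<open>Re s > 0\<close>; a polynomial is
  determined by its values there.\<close>

definition is_mellin_poly :: "real \<Rightarrow> nat \<Rightarrow> complex poly \<Rightarrow> bool" where
  "is_mellin_poly lam n P \<longleftrightarrow>
     (\<forall>s. Re s > 0 \<longrightarrow>
        mellinM lam n s =
          Gamma (of_real lam / 2 + 1 / 4) * Gamma ((s + of_nat (eps n)) / 2)
          / (2 * fact n * Gamma ((s + of_nat n + of_real lam) / 2 + 1 / 4)) * poly P s)"

definition mellin_poly :: "real \<Rightarrow> nat \<Rightarrow> complex poly" where
  "mellin_poly lam n = (THE P. is_mellin_poly lam n P)"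

definition p_even :: "real \<Rightarrow> nat \<Rightarrow> complex \<Rightarrow> complex" where
  "p_even lam n s =
     fact n * fact (2 * n) *
     (\<Sum>r=0..n. (-1)^(n - r) * 2 powi (2 * int r - 1)
        * ((of_nat n + of_nat r + of_real lam - 1) gchoose (n + r))
        * of_nat ((n + r) choose (2 * r))
        * ((s - 2) / 2 + of_nat r gchoose r)
        * (of_nat n + (s + of_real lam) / 2 - 3 / 4 gchoose (n - r))
        / of_nat (n choose r))"

definition p_odd :: "real \<Rightarrow> nat \<Rightarrow> complex \<Rightarrow> complex" where
  "p_odd lam n s =
     fact n * fact (2 * n + 1) *
     (\<Sum>r=0..n. (-1)^(n - r) * 2 ^ (2 * r)
        * ((of_nat n + of_nat r + of_real lam) gchoose (n + r + 1))
        * of_nat ((n + r + 1) choose (2 * r + 1))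
        * ((s - 1) / 2 + of_nat r gchoose r)
        * (of_nat n + (s + 1 + of_real lam) / 2 - 3 / 4 gchoose (n - r))
        / of_nat (n choose r))"

definition p :: "real \<Rightarrow> nat \<Rightarrow> complex \<Rightarrow> complex" where
  "p lam n s = (if even n then p_even lam (n div 2) s else p_odd lam (n div 2) s)"

text \<open>The sums common to the forms of type S:3/2 (Gould's classification) of \<open>p\<close> and to the definition of \<open>q\<close>.\<close>

definition S32_even :: "real \<Rightarrow> nat \<Rightarrow> complex \<Rightarrow> complex" where
  "S32_even lam n s =
     (\<Sum>r=0..n. (-1)^(n - r) * 2 powi (2 * int r - 1)
        * ((of_nat n + of_nat r + of_real lam - 1) gchoose r)
        * of_nat ((n + r) choose (2 * r))
        * ((s - 2) / 2 + of_nat r gchoose r)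
        / (of_nat ((n + r) choose r)
           * ((s + of_real lam) / 2 - 3 / 4 + of_nat r gchoose r)))"

definition S32_odd :: "real \<Rightarrow> nat \<Rightarrow> complex \<Rightarrow> complex" where
  "S32_odd lam n s =
     (\<Sum>r=0..n. (-1)^(n - r) * 2 ^ (2 * r)
        * ((of_nat n + of_nat r + of_real lam) gchoose r)
        * of_nat ((n + r + 1) choose (2 * r + 1))
        * ((s - 1) / 2 + of_nat r gchoose r)
        / (of_nat ((n + r + 1) choose r)
           * ((s + of_real lam) / 2 - 1 / 4 + of_nat r gchoose r)))"

definition q_even :: "real \<Rightarrow> nat \<Rightarrow> complex \<Rightarrow> complex" where
  "q_even lam n s =
     2 * of_nat n * (of_nat n + of_real lam - 1 gchoose n)
     / (of_real lam * Gbinom (2 * of_nat n + 2 * of_real lam - 1) (2 * of_nat n - 1))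
     * S32_even lam n s"

definition q_odd :: "real \<Rightarrow> nat \<Rightarrow> complex \<Rightarrow> complex" where
  "q_odd lam n s =
     (2 * of_nat n + 1) * (of_nat n + of_real lam gchoose (n + 1))
     / (of_real lam * Gbinom (2 * of_nat n + 2 * of_real lam) (2 * of_nat n))
     * S32_odd lam n s"

text \<open>Only meaningful for \<open>n \<ge> 1\<close>.\<close>

definition q :: "real \<Rightarrow> nat \<Rightarrow> complex \<Rightarrow> complex" where
  "q lam n s = (if even n then q_even lam (n div 2) s else q_odd lam (n div 2) s)"

text \<open>None of the \<open>s\<close>-dependent denominators occurring in the S:3/2-type forms of index \<open>n\<close>
  vanishes at \<open>s\<close>.  Since \<open>x / 0 = 0\<close>, identities of rational functions of \<open>s\<close> are stated
  pointwise at such \<open>s\<close> (all but finitely many).\<close>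

definition no_pole :: "real \<Rightarrow> nat \<Rightarrow> complex \<Rightarrow> bool" where
  "no_pole lam n s \<longleftrightarrow>
     (\<forall>r\<le>n div 2. ((s + of_real lam + of_nat (eps n)) / 2 - 3 / 4 + of_nat r gchoose r) \<noteq> 0)"

definition q_den :: "real \<Rightarrow> nat \<Rightarrow> complex \<Rightarrow> complex" where
  "q_den lam n s =
     (if even n then \<Prod>j=1..n div 2. 2 * s + 2 * of_real lam + 4 * of_nat j - 3
      else \<Prod>j=1..n div 2. 2 * s + 2 * of_real lam + 4 * of_nat j - 1)"

end

theory Submission
  imports Defs "HOL-Complex_Analysis.Complex_Analysis" "HOL-Real_Asymp.Real_Asymp"
    "HOL-Computational_Algebra.Fundamental_Theorem_Algebra"
begin

text \<open>Write \<open>m = n div 2\<close>, \<open>\<sigma> = s - 1/2\<close>, \<open>L = \<lambda> + \<epsilon>\<close>, \<open>d = \<lambda> + 1/2\<close>.  Up to elementary factors,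
  \<open>p\<close> and \<open>q\<close> are the terminating series \<open>3F2(-m, m + L, (s + \<epsilon>)/2; \<epsilon> + 1/2, (\<sigma> + L + 1)/2; 1)\<close>.
  As a function of \<open>m\<close> it satisfies the three-term recurrence of the Hahn polynomials, and on
  the present parameters the middle coefficient is a constant multiple of \<open>\<sigma>\<close>.  The normalized series \<open>F\<^sub>m\<close>
  thus satisfies, with positive \<open>\<alpha>\<close> and nonnegative \<open>\<beta>\<close>,
  \<open>\<alpha> (2m + L + 1 + \<sigma>) F\<^sub>m\<^sub>+\<^sub>1 = \<sigma> (\<alpha> + \<beta>) F\<^sub>m + \<beta> (2m + L - 1 - \<sigma>) F\<^sub>m\<^sub>-\<^sub>1\<close>.
  The reflection \<open>\<sigma> \<mapsto> -\<sigma>\<close> follows by induction.  For \<open>\<sigma> > 0\<close>, induction also gives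
  \<open>\<sigma> F\<^sub>m \<le> (2m + L + 1 + \<sigma>) F\<^sub>m\<^sub>+\<^sub>1\<close>, hence positivity, and then \<open>F\<^sub>m < 1\<close> and the limit \<open>1\<close> at infinity.
  Every pole \<open>s\<close> of \<open>q\<close> has \<open>1 - s > 1\<close>, where \<open>p\<close> is positive up to a constant; by reflection \<open>p\<close> does not
  vanish at the pole, so the fraction is reduced.  Finally, the Mellin transform is a sum of
  Beta integrals, which extend from real to complex arguments by analytic continuation.\<close>

subsection \<open>The recurrence of the Hahn series\<close>

text \<open>This is the terminating series \<open>3F2(-n, n + L, f; g, e; 1)\<close>. Read in the
  variable \<open>f\<close> it is a Hahn polynomial, with \<open>f\<close> in the role of
  \<open>-x\<close> and \<open>e\<close> in the role of the lower parameter
  \<open>-N\<close>.\<close>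

definition hyp32 :: "'a::field_char_0 \<Rightarrow> 'a \<Rightarrow> 'a \<Rightarrow> 'a \<Rightarrow> nat \<Rightarrow> 'a" where
  "hyp32 L g f e n = (\<Sum>k\<le>n. pochhammer (- of_nat n) k * pochhammer (of_nat n + L) k
     * pochhammer f k / (pochhammer g k * pochhammer e k * fact k))"

text \<open>Collects what does not depend on \<open>f\<close>, so that identities in
  \<open>f\<close> can be checked on the coefficients of the rising factorials
  \<open>pochhammer f k\<close>.\<close>

definition hahn_coeff :: "'a::field_char_0 \<Rightarrow> 'a \<Rightarrow> 'a \<Rightarrow> nat \<Rightarrow> nat \<Rightarrow> 'a" where
  "hahn_coeff L g e n k = pochhammer (- of_nat n) k * pochhammer (of_nat n + L) k
     / (pochhammer g k * pochhammer e k * fact k)"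

lemma hahn_coeff_eq_0: "k > n \<Longrightarrow> hahn_coeff L g e n k = 0"
  by (simp add: hahn_coeff_def pochhammer_of_nat_eq_0_lemma)

lemma hyp32_conv_hahn_coeff:
  assumes "n \<le> N"
  shows "hyp32 L g f e n = (\<Sum>k\<le>N. hahn_coeff L g e n k * pochhammer f k)"
proof -
  have "hyp32 L g f e n = (\<Sum>k\<le>n. hahn_coeff L g e n k * pochhammer f k)"
    by (simp add: hyp32_def hahn_coeff_def)
  also have "\<dots> = (\<Sum>k\<le>N. hahn_coeff L g e n k * pochhammer f k)"
    using assms by (intro sum.mono_neutral_left) (auto simp: hahn_coeff_eq_0)
  finally show ?thesis .
qed

text \<open>This is the coefficient of \<open>pochhammer f (Suc k)\<close> in the recurrence below.
  The left side comes from \<open>f * pochhammer f k = pochhammer f (Suc k) - of_nat k * pochhammer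
  f k\<close>; \<open>A\<close> and \<open>C\<close> are the classical Hahn recurrence coefficients.
  All terms are rational multiples of one quantity, so a rational identity remains.\<close>

lemma hahn_coeff_recurrence:
  fixes L g e :: "'a::field_char_0"
  assumes n: "n \<ge> 1" and k: "k \<le> n"
    and nz: "of_nat n + L \<noteq> 0" "2 * of_nat n + L \<noteq> 0"
      "2 * of_nat n + L + 1 \<noteq> 0" "2 * of_nat n + L - 1 \<noteq> 0"
    and g: "pochhammer g (Suc n) \<noteq> 0" and e: "pochhammer e (Suc n) \<noteq> 0"
  defines "A \<equiv> - (of_nat n + L) * (of_nat n + g) * (of_nat n + e)
                 / ((2 * of_nat n + L) * (2 * of_nat n + L + 1))"
    and "C \<equiv> of_nat n * (of_nat n + L - e) * (of_nat n + L - g)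
                 / ((2 * of_nat n + L - 1) * (2 * of_nat n + L))"
  shows "hahn_coeff L g e n k - of_nat (Suc k) * hahn_coeff L g e n (Suc k) =
     A * hahn_coeff L g e (n + 1) (Suc k) - (A + C) * hahn_coeff L g e n (Suc k)
       + C * hahn_coeff L g e (n - 1) (Suc k)"
proof -
  define N :: 'a where "N = of_nat n"
  define K :: 'a where "K = of_nat k"
  have N0: "N \<noteq> 0" using n by (simp add: N_def)
  have gk: "pochhammer g k \<noteq> 0" "g + K \<noteq> 0" and ek: "pochhammer e k \<noteq> 0" "e + K \<noteq> 0"
    using pochhammer_neq_0_mono[OF g, of "Suc k"] pochhammer_neq_0_mono[OF e, of "Suc k"] k
    by (auto simp: pochhammer_Suc K_def)
  have K1: "1 + K \<noteq> 0" by (metis K_def of_nat_Suc of_nat_neq_0)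
  \<comment> \<open>The additional divisor \<open>(g + K) * (e + K) * (1 + K)\<close> is what
    \<open>Suc k\<close> adds to the denominator of index \<open>k\<close>; with it every
    coefficient below is \<open>X\<close> times a simple expression.\<close>
  define X where "X = pochhammer (- N) k * pochhammer (N + L) k
      / (pochhammer g k * pochhammer e k * fact k) / ((g + K) * (e + K) * (1 + K))"
  have c0: "hahn_coeff L g e n k = X * ((g + K) * (e + K) * (1 + K))"
    using gk ek K1 by (simp add: X_def hahn_coeff_def N_def)
  have c1: "hahn_coeff L g e n (Suc k) = X * (K - N) * (N + L + K)"
    by (simp add: X_def hahn_coeff_def N_def K_def pochhammer_Suc mult_ac)
  have p1: "pochhammer (- of_nat (n + 1)) (Suc k) = - (N + 1) * pochhammer (- N) k"
    by (simp add: N_def pochhammer_rec add.commute)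
  have "pochhammer (N + L) (Suc (Suc k)) = (N + L) * pochhammer (of_nat (n + 1) + L) (Suc k)"
    by (simp add: N_def pochhammer_rec[of _ "Suc k"] add_ac)
  hence p2: "pochhammer (of_nat (n + 1) + L) (Suc k)
      = pochhammer (N + L) k * (N + L + K) * (N + L + K + 1) / (N + L)"
    using nz by (simp add: pochhammer_Suc N_def K_def field_simps)
  have c2: "hahn_coeff L g e (n + 1) (Suc k)
      = X * (- (N + 1)) * (N + L + K) * (N + L + K + 1) / (N + L)"
    unfolding hahn_coeff_def p1 p2
    by (simp add: X_def K_def pochhammer_Suc mult_ac)
  have "pochhammer (- N) (Suc (Suc k)) = (- N) * pochhammer (- of_nat (n - 1)) (Suc k)"
    using n by (simp add: N_def pochhammer_rec[of _ "Suc k"] of_nat_diff)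
  hence p3: "pochhammer (- of_nat (n - 1)) (Suc k)
      = pochhammer (- N) k * (K - N) * (K - N + 1) / (- N)"
    using N0 by (simp add: pochhammer_Suc N_def K_def field_simps)
  have p4: "pochhammer (of_nat (n - 1) + L) (Suc k) = (N + L - 1) * pochhammer (N + L) k"
    using n by (simp add: N_def pochhammer_rec of_nat_diff algebra_simps)
  have c3: "hahn_coeff L g e (n - 1) (Suc k)
      = X * (K - N) * (K - N + 1) / (- N) * (N + L - 1)"
    unfolding hahn_coeff_def p3 p4
    by (simp add: X_def K_def pochhammer_Suc mult_ac)
  \<comment> \<open>The divisors \<open>N + L\<close> in \<open>c2\<close> and \<open>- N\<close> in
    \<open>c3\<close> cancel against factors of \<open>A\<close> and \<open>C\<close>.\<close>
  have A: "A / (N + L) = - (N + g) * (N + e) / ((2 * N + L) * (2 * N + L + 1))"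
    using nz unfolding A_def N_def minus_mult_left[symmetric] by (simp add: mult_ac)
  have C: "C / (- N) = - (N + L - e) * (N + L - g) / ((2 * N + L - 1) * (2 * N + L))"
    using N0 unfolding C_def N_def minus_mult_left[symmetric] by (simp add: mult_ac)
  \<comment> \<open>Trading \<open>L\<close> for \<open>M\<close> reduces the denominators to
    \<open>M\<close>, \<open>M + 1\<close> and \<open>M - 1\<close>; after clearing them a
    polynomial identity is left.\<close>
  define M where "M = 2 * N + L"
  have M: "M \<noteq> 0" "M + 1 \<noteq> 0" "M - 1 \<noteq> 0" and LM: "L = M - 2 * N"
    using nz by (simp_all add: M_def N_def)
  have "X * ((g + K) * (e + K) * (1 + K)) - (1 + K) * (X * (K - N) * (N + L + K)) =
    (A / (N + L)) * (X * (- (N + 1)) * (N + L + K) * (N + L + K + 1))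
      - ((A / (N + L)) * (N + L) + (C / (-N)) * (- N)) * (X * (K - N) * (N + L + K))
      + (C / (- N)) * (X * (K - N) * (K - N + 1) * (N + L - 1))"
    unfolding A C M_def[symmetric] using M unfolding LM
    by (simp add: divide_simps) algebra
  also have "(A / (N + L)) * (N + L) = A" using nz by (simp add: N_def)
  also have "(C / (-N)) * (- N) = C" using N0 by simp
  finally show ?thesis unfolding c0 c1 c2 c3 by (simp add: K_def)
qed

text \<open>Multiplication by \<open>f\<close> sends \<open>pochhammer f k\<close> to a combination
  of itself and \<open>pochhammer f (Suc k)\<close>, so the claim can be compared coefficientwise in
  this basis.\<close>

lemma hyp32_recurrence:
  fixes L g e f :: "'a::field_char_0"
  assumes n: "n \<ge> 1" 
    and nz: "of_nat n + L \<noteq> 0" "2 * of_nat n + L \<noteq> 0"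
      "2 * of_nat n + L + 1 \<noteq> 0" "2 * of_nat n + L - 1 \<noteq> 0"
    and g: "pochhammer g (Suc n) \<noteq> 0" and e: "pochhammer e (Suc n) \<noteq> 0"
  defines "A \<equiv> - (of_nat n + L) * (of_nat n + g) * (of_nat n + e)
                 / ((2 * of_nat n + L) * (2 * of_nat n + L + 1))"
    and "C \<equiv> of_nat n * (of_nat n + L - e) * (of_nat n + L - g)
                 / ((2 * of_nat n + L - 1) * (2 * of_nat n + L))"
  shows "f * hyp32 L g f e n
     = A * hyp32 L g f e (n + 1) - (A + C) * hyp32 L g f e n + C * hyp32 L g f e (n - 1)"
proof -
  let ?c = "hahn_coeff L g e"
  have "f * hyp32 L g f e n = (\<Sum>k\<le>n. ?c n k * (f * pochhammer f k))"
    by (simp add: hyp32_conv_hahn_coeff[of n n] sum_distrib_left mult_ac)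
  also have "\<dots> = (\<Sum>k\<le>n. ?c n k * (pochhammer f (Suc k) - of_nat k * pochhammer f k))"
    by (simp add: pochhammer_Suc algebra_simps)
  \<comment> \<open>The second sum receives the zero term \<open>k = Suc n\<close>; dropping its
    vanishing term \<open>k = 0\<close> and shifting then leaves the range
    \<open>k \<le> n\<close>.\<close>
  also have "\<dots> = (\<Sum>k\<le>n. ?c n k * pochhammer f (Suc k)) - (\<Sum>k\<le>Suc n. of_nat k * ?c n k * pochhammer f k)"
    by (simp add: right_diff_distrib sum_subtractf hahn_coeff_eq_0 mult_ac)
  also have "(\<Sum>k\<le>Suc n. of_nat k * ?c n k * pochhammer f k)
      = (\<Sum>k\<le>n. of_nat (Suc k) * ?c n (Suc k) * pochhammer f (Suc k))"
    by (subst sum.atMost_Suc_shift) simp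
  also have "(\<Sum>k\<le>n. ?c n k * pochhammer f (Suc k)) - \<dots>
      = (\<Sum>k\<le>n. (?c n k - of_nat (Suc k) * ?c n (Suc k)) * pochhammer f (Suc k))"
    by (simp only: sum_subtractf left_diff_distrib)
  also have "\<dots> = (\<Sum>k\<le>n. (A * ?c (n + 1) (Suc k) - (A + C) * ?c n (Suc k) + C * ?c (n - 1) (Suc k))
      * pochhammer f (Suc k))"
    by (intro sum.cong refl arg_cong2[where f = "(*)"], unfold A_def C_def)
       (rule hahn_coeff_recurrence, use assms in auto)
  \<comment> \<open>The new term \<open>k = 0\<close> vanishes: all three coefficients are 1 there,
    and \<open>A - (A + C) + C = 0\<close>.\<close>
  also have "\<dots> = (\<Sum>k\<le>Suc n. (A * ?c (n + 1) k - (A + C) * ?c n k + C * ?c (n - 1) k)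
      * pochhammer f k)"
    unfolding sum.atMost_Suc_shift[of _ n] by (simp add: hahn_coeff_def)
  also have "\<dots> = A * hyp32 L g f e (n + 1) - (A + C) * hyp32 L g f e n + C * hyp32 L g f e (n - 1)"
    by (simp add: hyp32_conv_hahn_coeff[of _ "Suc n"] sum.distrib sum_subtractf sum_distrib_left
         algebra_simps del: sum.atMost_Suc)
  finally show ?thesis .
qed

text \<open>The choice \<open>f = e - d / 2\<close> is what makes the middle coefficient of the
  recurrence proportional to \<sigma>. As \<sigma> grows, \<open>f\<close> and \<open>e\<close>
  become comparable and the series tends to \<open>2F1(-n, n + L; g; 1)\<close>, which by
  Chu-Vandermonde is the reciprocal of the prefactor; the normalized limit is thus 1.\<close>

definition hyp32_normalized :: "'a::field_char_0 \<Rightarrow> 'a \<Rightarrow> 'a \<Rightarrow> nat \<Rightarrow> 'a" where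
  "hyp32_normalized L d \<sigma> n = (let g = L - d + 1; e = (\<sigma> + L + 1) / 2 in
     (-1) ^ n * pochhammer g n / pochhammer d n * hyp32 L g (e - d / 2) e n)"

lemma hyp32_normalized_0 [simp]: "hyp32_normalized L d \<sigma> 0 = 1"
  by (simp add: hyp32_normalized_def hyp32_def)

text \<open>The second initial value. It has the form of the recurrence at \<open>n = 0\<close>, but
  is computed directly because \<open>L\<close> or \<open>L - 1\<close> may vanish there.\<close>

lemma hyp32_normalized_1:
  assumes "d \<noteq> 0" "L - d + 1 \<noteq> 0" "\<sigma> + L + 1 \<noteq> 0"
  shows "hyp32_normalized L d \<sigma> (Suc 0) = \<sigma> / (1 + L + \<sigma>)"
proof -
  define e where "e = (\<sigma> + L + 1) / 2"
  have \<sigma>: "\<sigma> = 2 * e - L - 1" and e: "e \<noteq> 0" using assms by (simp_all add: e_def field_simps)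
  define g where "g = L - d + 1"
  have L: "L = g + d - 1" and g: "g \<noteq> 0" using assms by (simp_all add: g_def)
  have "hyp32_normalized L d \<sigma> (Suc 0) = - g / d * (1 - (1 + L) * (e - d / 2) / (g * e))"
    unfolding hyp32_normalized_def hyp32_def Let_def e_def[symmetric] g_def[symmetric]
    by (simp add: minus_mult_left[symmetric] del: minus_add_distrib)
  also have "\<dots> = (2 * e - L - 1) / (2 * e)"
    using assms e g unfolding L by (simp add: divide_simps) algebra
  finally show ?thesis by (simp add: \<sigma>)
qed

text \<open>The Hahn recurrence with the normalizing factors of the indices \<open>n - 1\<close>,
  \<open>n\<close> and \<open>n + 1\<close> absorbed into its coefficients. The outer coefficients
  keep one linear factor in \<sigma> each, the middle one becomes a multiple of \<sigma>.\<close>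

lemma hyp32_normalized_recurrence:
  fixes L d \<sigma> :: "'a::field_char_0"
  assumes n: "n \<ge> 1" 
    and nz: "of_nat n + L \<noteq> 0" "2 * of_nat n + L \<noteq> 0"
      "2 * of_nat n + L + 1 \<noteq> 0" "2 * of_nat n + L - 1 \<noteq> 0"
    and g: "pochhammer (L - d + 1) (Suc n) \<noteq> 0" and d: "pochhammer d (Suc n) \<noteq> 0"
    and e: "pochhammer ((\<sigma> + L + 1) / 2) (Suc n) \<noteq> 0"
  defines "\<alpha> \<equiv> (of_nat n + L) * (of_nat n + d) / (2 * of_nat n + L + 1)"
    and "\<beta> \<equiv> of_nat n * (of_nat n + L - d) / (2 * of_nat n + L - 1)"
  shows "\<alpha> * (2 * of_nat n + L + 1 + \<sigma>) * hyp32_normalized L d \<sigma> (Suc n)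
     = \<sigma> * (\<alpha> + \<beta>) * hyp32_normalized L d \<sigma> n
       + \<beta> * (2 * of_nat n + L - 1 - \<sigma>) * hyp32_normalized L d \<sigma> (n - 1)"
proof -
  obtain m where m: "n = Suc m" using n by (cases n) auto
  define N :: 'a where "N = of_nat n"
  define gg ee where "gg = L - d + 1" and "ee = (\<sigma> + L + 1) / 2"
  define U where "U = hyp32 L gg (ee - d / 2) ee"
  define A C where "A = - (N + L) * (N + gg) * (N + ee) / ((2 * N + L) * (2 * N + L + 1))"
    and "C = N * (N + L - ee) * (N + L - gg) / ((2 * N + L - 1) * (2 * N + L))"
  have rec: "A * U (Suc n) = (ee - d / 2 + A + C) * U n - C * U (n - 1)"
    using hyp32_recurrence[OF n nz g e, of "ee - d / 2"]
    by (simp add: A_def C_def U_def N_def gg_def ee_def algebra_simps)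
  \<comment> \<open>The normalizing factor at index \<open>n - 1\<close>; those at \<open>n\<close>
    and \<open>n + 1\<close> are expressed through it in \<open>F1\<close> and
    \<open>F2\<close>.\<close>
  define c where "c = (-1) ^ m * pochhammer gg m / pochhammer d m"
  have poch: "pochhammer x (Suc n) = pochhammer x m * (x + N - 1) * (x + N)" for x :: 'a
    by (simp add: m pochhammer_Suc N_def add_ac)
  have poch': "pochhammer x n = pochhammer x m * (x + N - 1)" for x :: 'a
    by (simp add: m pochhammer_Suc N_def add_ac)
  have gm: "gg + N - 1 \<noteq> 0" "gg + N \<noteq> 0" "pochhammer gg m \<noteq> 0"
    using g unfolding gg_def[symmetric] poch by auto
  have dm: "d + N - 1 \<noteq> 0" "d + N \<noteq> 0" "pochhammer d m \<noteq> 0"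
    using d unfolding poch by auto
  have F: "hyp32_normalized L d \<sigma> k = (-1) ^ k * pochhammer gg k / pochhammer d k * U k" for k
    by (simp add: hyp32_normalized_def Let_def gg_def ee_def U_def)
  have F1: "hyp32_normalized L d \<sigma> (Suc n)
      = c * (gg + N - 1) * (gg + N) / ((d + N - 1) * (d + N)) * U (Suc n)"
    unfolding F poch c_def by (simp add: m mult.assoc)
  have F2: "hyp32_normalized L d \<sigma> n = - c * (gg + N - 1) / (d + N - 1) * U n"
    unfolding F poch' c_def by (simp add: m)
  have F3: "hyp32_normalized L d \<sigma> (n - 1) = c * U (n - 1)"
    unfolding F c_def by (simp add: m)
  define M where "M = 2 * N + L"
  have M: "M \<noteq> 0" "M + 1 \<noteq> 0" "M - 1 \<noteq> 0" and LM: "L = M - 2 * N"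
    using nz by (simp_all add: M_def N_def)
  have \<sigma>: "\<sigma> = 2 * ee - L - 1" by (simp add: ee_def field_simps)
  have gd: "d = L - gg + 1" by (simp add: gg_def)
  have a: "\<alpha> * (2 * N + L + 1 + \<sigma>) * (gg + N) / (d + N) = - 2 * M * A"
    using M dm by (simp add: \<alpha>_def A_def N_def[symmetric] M_def[symmetric] \<sigma> divide_simps)
      (simp add: M_def, algebra)
  have b: "\<beta> * (2 * N + L - 1 - \<sigma>) * (d + N - 1) = 2 * M * C * (gg + N - 1)"
    using M by (simp add: \<beta>_def C_def N_def[symmetric] M_def[symmetric] \<sigma> divide_simps)
      (simp add: M_def gd, algebra)
  \<comment> \<open>The decisive cancellation: the terms of \<open>f + A + C\<close> free of
    \<sigma> disappear for \<open>f = ee - d / 2\<close>. The reflection symmetry rests on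
    it.\<close>
  have ab: "\<sigma> * (\<alpha> + \<beta>) = 2 * M * (ee - d / 2 + A + C)"
    using M unfolding \<alpha>_def \<beta>_def A_def C_def \<sigma> N_def[symmetric] M_def[symmetric] unfolding gd LM
    by (simp add: divide_simps) algebra
  have "\<alpha> * (2 * N + L + 1 + \<sigma>) * hyp32_normalized L d \<sigma> (Suc n)
     = c * (gg + N - 1) / (d + N - 1) * (\<alpha> * (2 * N + L + 1 + \<sigma>) * (gg + N) / (d + N) * U (Suc n))"
    unfolding F1 by (simp add: mult_ac)
  also have "\<dots> = - 2 * M * c * (gg + N - 1) / (d + N - 1) * (A * U (Suc n))"
    unfolding a by (simp add: mult_ac)
  also have "\<dots> = 2 * M * (ee - d / 2 + A + C) * (- c * (gg + N - 1) / (d + N - 1) * U n)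
      + (2 * M * C * (gg + N - 1)) * c / (d + N - 1) * U (n - 1)"
    unfolding rec by (simp add: algebra_simps diff_divide_distrib add_divide_distrib)
  also have "\<dots> = \<sigma> * (\<alpha> + \<beta>) * hyp32_normalized L d \<sigma> n + \<beta> * (2 * N + L - 1 - \<sigma>) * (c * U (n - 1))"
    unfolding ab[symmetric] b[symmetric] F2 using dm by simp
  finally show ?thesis unfolding F3 N_def .
qed

text \<open>If \<sigma> does not exceed \<open>2n + L - 1\<close>, the right side of the recurrence
  has nonnegative coefficients, whose sum is below the coefficient on the left, and both bounds
  propagate at once. For larger \<sigma> the last coefficient may be negative; positivity then
  relies on the ratio bound carried along, and the upper bound on monotonicity.\<close>

lemma three_term_positive_bounds:
  fixes L d \<sigma> :: real and F :: "nat \<Rightarrow> real"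
  defines "\<alpha> \<equiv> \<lambda>n. (real n + L) * (real n + d) / (2 * real n + L + 1)"
    and "\<beta> \<equiv> \<lambda>n. real n * (real n + L - d) / (2 * real n + L - 1)"
  assumes L: "L > -1" and d: "d > 0" "d < L + 1" and \<sigma>: "\<sigma> > 0"
    and F0: "F 0 = 1" and F1: "F (Suc 0) = \<sigma> / (1 + L + \<sigma>)"
    and rec: "\<And>n. n \<ge> 1 \<Longrightarrow> \<alpha> n * (2 * real n + L + 1 + \<sigma>) * F (Suc n)
         = \<sigma> * (\<alpha> n + \<beta> n) * F n + \<beta> n * (2 * real n + L - 1 - \<sigma>) * F (n - 1)"
  shows "F n > 0" and "(2 * real n + L + 1 + \<sigma>) * F (Suc n) \<ge> \<sigma> * F n"
    and "F (Suc n) < 1"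
proof -
  have \<alpha>: "\<alpha> n > 0" if "n \<ge> 1" for n using that L d by (auto simp: \<alpha>_def)
  have \<beta>: "\<beta> n \<ge> 0" if "n \<ge> 1" for n using that L d by (auto simp: \<beta>_def)
  \<comment> \<open>The two sides differ by exactly the amount by which the left coefficient of the
    recurrence exceeds the sum of the two right ones, as the terms with \<sigma> cancel.\<close>
  have diff: "\<beta> n * (2 * real n + L - 1) < \<alpha> n * (2 * real n + L + 1)" if "n \<ge> 1" for n
  proof -
    have "\<beta> n * (2 * real n + L - 1) = n * (n + L - d)" "\<alpha> n * (2 * real n + L + 1) = (n + L) * (n + d)"
      using that L by (auto simp: \<alpha>_def \<beta>_def)
    moreover have "(n + L) * (n + d) - n * (n + L - d) = d * (2 * real n + L)"
      by (simp add: algebra_simps)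
    moreover have "d * (2 * real n + L) > 0" using d L that by simp
    ultimately show ?thesis by linarith
  qed
  have lower: "F n > 0 \<and> F (Suc n) > 0 \<and> (2 * real n + L + 1 + \<sigma>) * F (Suc n) \<ge> \<sigma> * F n" for n
  proof (induction n)
    case 0
    have "F (Suc 0) > 0" "(L + 1 + \<sigma>) * F (Suc 0) = \<sigma>"
      unfolding F1 using L \<sigma> by (auto simp: field_simps)
    then show ?case using F0 by simp
  next
    case (Suc n)
    define m w where "m = Suc n" and "w = 2 * real m + L - 1"
    have m: "m \<ge> 1" by (simp add: m_def)
    have w: "w > 0" using L by (simp add: w_def m_def)
    have pos: "F n > 0" "F m > 0" and IH: "(w + \<sigma>) * F m \<ge> \<sigma> * F n"
      using Suc by (auto simp: m_def w_def add_ac)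
    \<comment> \<open>By the recurrence, \<beta> times this sum is \<alpha> times the defect in the
      ratio bound at the next index. When \<sigma> exceeds \<open>w\<close>, multiply by
      \<open>w + \<sigma>\<close>: the ratio bound of the hypothesis leaves
      \<open>w\<^sup>2 * F n\<close> as a lower estimate.\<close>
    have "\<sigma> * F m + (w - \<sigma>) * F n \<ge> 0"
    proof (cases "w \<ge> \<sigma>")
      case True
      then show ?thesis using pos \<sigma> by (intro add_nonneg_nonneg mult_nonneg_nonneg) auto
    next
      case False
      have "0 \<le> w\<^sup>2 * F n" using pos by simp
      also have "\<dots> = \<sigma> * (\<sigma> * F n) + (w + \<sigma>) * ((w - \<sigma>) * F n)"
        by (simp add: algebra_simps power2_eq_square)
      also have "\<dots> \<le> \<sigma> * ((w + \<sigma>) * F m) + (w + \<sigma>) * ((w - \<sigma>) * F n)"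
        using IH \<sigma> by (intro add_right_mono mult_left_mono) auto
      also have "\<dots> = (w + \<sigma>) * (\<sigma> * F m + (w - \<sigma>) * F n)" by (simp add: algebra_simps)
      finally show ?thesis using w \<sigma> by (simp add: zero_le_mult_iff)
    qed
    hence "0 \<le> \<beta> m * (\<sigma> * F m + (w - \<sigma>) * F n)" using \<beta>[OF m] by simp
    also have "\<dots> = \<sigma> * (\<alpha> m + \<beta> m) * F m + \<beta> m * (w - \<sigma>) * F n - \<alpha> m * \<sigma> * F m"
      by (simp add: algebra_simps)
    also have "\<dots> = \<alpha> m * ((w + 2 + \<sigma>) * F (Suc m) - \<sigma> * F m)"
      using rec[OF m] by (simp add: m_def w_def algebra_simps)
    finally have *: "(w + 2 + \<sigma>) * F (Suc m) \<ge> \<sigma> * F m"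
      using \<alpha>[OF m] by (simp add: zero_le_mult_iff)
    moreover have "\<sigma> * F m > 0" using \<sigma> pos by simp
    ultimately have "F (Suc m) > 0" using w \<sigma> by (smt (verit) zero_less_mult_iff)
    with * pos show ?case by (simp add: m_def w_def)
  qed
  show "F n > 0" and "(2 * real n + L + 1 + \<sigma>) * F (Suc n) \<ge> \<sigma> * F n" using lower by auto
  \<comment> \<open>The last clause records the two regimes: while \<sigma> is above
    \<open>2n + L + 1\<close> the sequence decreases, and once it is below, it stays below because
    this threshold grows with \<open>n\<close>.\<close>
  have "F n \<le> 1 \<and> F (Suc n) < 1 \<and> (F (Suc n) \<le> F n \<or> \<sigma> \<le> 2 * real n + L + 1)"
  proof (induction n)
    case 0
    have "F (Suc 0) < 1" unfolding F1 using L \<sigma> by simp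
    then show ?case using F0 by simp
  next
    case (Suc n)
    define m w where "m = Suc n" and "w = 2 * real m + L - 1"
    have m: "m \<ge> 1" by (simp add: m_def)
    have w: "w > 0" using L by (simp add: w_def m_def)
    have IH: "F n \<le> 1" "F m < 1" "F m \<le> F n \<or> \<sigma> \<le> w"
      using Suc by (auto simp: m_def w_def)
    have eq: "\<alpha> m * (w + 2 + \<sigma>) * F (Suc m) = \<sigma> * (\<alpha> m + \<beta> m) * F m + \<beta> m * (w - \<sigma>) * F n"
      using rec[OF m] by (simp add: m_def w_def algebra_simps)
    have dw: "\<beta> m * w < \<alpha> m * (w + 2)" using diff[OF m] by (simp add: w_def add_ac)
    have lhs: "\<alpha> m * (w + 2 + \<sigma>) > 0" using \<alpha>[OF m] w \<sigma> by simp
    show ?case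
    proof (cases "\<sigma> \<le> w")
      case True
      have "\<sigma> * (\<alpha> m + \<beta> m) * F m + \<beta> m * (w - \<sigma>) * F n
          \<le> \<sigma> * (\<alpha> m + \<beta> m) * 1 + \<beta> m * (w - \<sigma>) * 1"
        using True IH \<alpha>[OF m] \<beta>[OF m] \<sigma> by (intro add_mono mult_left_mono) auto
      also have "\<dots> < \<alpha> m * (w + 2 + \<sigma>) * 1" using dw by (simp add: algebra_simps)
      finally have "F (Suc m) < 1" unfolding eq[symmetric] using lhs mult_less_cancel_left_pos by blast
      thus ?thesis using IH True by (auto simp: m_def w_def)
    next
      case False
      hence "\<beta> m * (w - \<sigma>) * F n \<le> \<beta> m * (w - \<sigma>) * F m"
        using IH \<beta>[OF m] by (intro mult_left_mono_neg) (auto simp: mult_nonneg_nonpos)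
      hence "\<sigma> * (\<alpha> m + \<beta> m) * F m + \<beta> m * (w - \<sigma>) * F n
          \<le> \<sigma> * (\<alpha> m + \<beta> m) * F m + \<beta> m * (w - \<sigma>) * F m"
        by simp
      also have "\<dots> = (\<sigma> * \<alpha> m + \<beta> m * w) * F m" by (simp add: algebra_simps)
      also have "\<dots> < (\<alpha> m * (w + 2 + \<sigma>)) * F m"
        using dw lower[of n] by (intro mult_strict_right_mono) (auto simp: m_def algebra_simps)
      finally have "F (Suc m) < F m" unfolding eq[symmetric] using lhs mult_less_cancel_left_pos by blast
      thus ?thesis using IH by (auto simp: m_def)
    qed
  qed
  thus "F (Suc n) < 1" by blast
qed

lemma hyp32_normalized_of_real:
  "hyp32_normalized (of_real L) (of_real d) (of_real \<sigma>) n
     = (of_real (hyp32_normalized L d \<sigma> n) :: 'a :: {real_field})"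
proof -
  have *: "pochhammer (of_real x) k = (of_real (pochhammer x k) :: 'a)" for x k
    by (rule pochhammer_of_real)
  have "hyp32 (of_real L) (of_real g) (of_real f) (of_real e) n = (of_real (hyp32 L g f e n) :: 'a)"
    for g f e
    unfolding hyp32_def of_real_sum of_real_divide of_real_mult *[symmetric] by simp
  from this[of "L - d + 1" "(\<sigma> + L + 1) / 2 - d / 2" "(\<sigma> + L + 1) / 2"] show ?thesis
    using *[of d n] *[of "L - d + 1" n] by (simp add: hyp32_normalized_def Let_def)
qed

section \<open>Bounds, limit and reflection of the normalized series for real \<open>L\<close> and
  \<open>d\<close>\<close>

context
  fixes L d :: real
  assumes L: "L > -1" and d: "d > 0" "d < L + 1"
begin

text \<open>The conditions on \<open>L\<close> and \<open>d\<close> keep all divisors independent of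
  \<sigma> away from zero, so only the condition on the lower parameter remains. The field is left
  general: the bounds use it over the reals, the reflection over the complex numbers.\<close>

lemma hyp32_normalized_recurrence_real:
  fixes \<sigma> :: "'a :: real_field"
  defines "F \<equiv> hyp32_normalized (of_real L) (of_real d) \<sigma>"
    and "\<alpha> \<equiv> \<lambda>n. (real n + L) * (real n + d) / (2 * real n + L + 1)"
    and "\<beta> \<equiv> \<lambda>n. real n * (real n + L - d) / (2 * real n + L - 1)"
  assumes n: "n \<ge> 1" and e: "pochhammer ((\<sigma> + of_real L + 1) / 2) (Suc n) \<noteq> 0"
  shows "of_real (\<alpha> n) * (2 * of_nat n + of_real L + 1 + \<sigma>) * F (Suc n)
      = \<sigma> * of_real (\<alpha> n + \<beta> n) * F n + of_real (\<beta> n) * (2 * of_nat n + of_real L - 1 - \<sigma>) * F (n - 1)"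
proof -
  have nz: "of_nat n + of_real L \<noteq> (0::'a)" "2 * of_nat n + of_real L \<noteq> (0::'a)"
    "2 * of_nat n + of_real L + 1 \<noteq> (0::'a)" "2 * of_nat n + of_real L - 1 \<noteq> (0::'a)"
  proof -
    have "real n + L \<noteq> 0" "2 * real n + L \<noteq> 0" "2 * real n + L + 1 \<noteq> 0" "2 * real n + L - 1 \<noteq> 0"
      using n L by linarith+
    hence "of_real (real n + L) \<noteq> (0::'a)" "of_real (2 * real n + L) \<noteq> (0::'a)"
      "of_real (2 * real n + L + 1) \<noteq> (0::'a)" "of_real (2 * real n + L - 1) \<noteq> (0::'a)"
      by (simp_all only: of_real_eq_0_iff not_False_eq_True)
    thus "of_nat n + of_real L \<noteq> (0::'a)" "2 * of_nat n + of_real L \<noteq> (0::'a)"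
      "2 * of_nat n + of_real L + 1 \<noteq> (0::'a)" "2 * of_nat n + of_real L - 1 \<noteq> (0::'a)" by simp_all
  qed
  have "pochhammer (of_real (L - d + 1)) (Suc n) \<noteq> (0::'a)" "pochhammer (of_real d) (Suc n) \<noteq> (0::'a)"
    unfolding pochhammer_of_real of_real_eq_0_iff
    using pochhammer_pos[of "L - d + 1" "Suc n"] pochhammer_pos[of d "Suc n"] d by simp_all
  thus ?thesis unfolding F_def \<alpha>_def \<beta>_def
    using hyp32_normalized_recurrence[OF n nz _ _ e, of "of_real d"] by simp
qed

lemma hyp32_normalized_1_real:
  fixes \<sigma> :: "'a :: real_field"
  assumes "\<sigma> + of_real L + 1 \<noteq> 0"
  shows "hyp32_normalized (of_real L) (of_real d) \<sigma> (Suc 0) = \<sigma> / (1 + of_real L + \<sigma>)"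
proof -
  have "of_real d \<noteq> (0::'a)" "of_real (L - d + 1) \<noteq> (0::'a)"
    using d unfolding of_real_eq_0_iff by auto
  thus ?thesis using assms by (intro hyp32_normalized_1) simp_all
qed

lemma hyp32_normalized_bounds:
  fixes \<sigma> :: real
  assumes \<sigma>: "\<sigma> > 0"
  shows "hyp32_normalized L d \<sigma> n > 0"
    and "hyp32_normalized L d \<sigma> (Suc n) \<ge> \<sigma> / (2 * real n + L + 1 + \<sigma>) * hyp32_normalized L d \<sigma> n"
    and "hyp32_normalized L d \<sigma> (Suc n) < 1"
proof -
  have poch: "pochhammer ((\<sigma> + L + 1) / 2) (Suc n) \<noteq> 0" for n
    using pochhammer_pos[of "(\<sigma> + L + 1) / 2" "Suc n"] L \<sigma> by simp
  have 1: "hyp32_normalized L d \<sigma> (Suc 0) = \<sigma> / (1 + L + \<sigma>)"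
    using hyp32_normalized_1_real[of \<sigma>] L \<sigma> by simp
  have rec: "(real n + L) * (real n + d) / (2 * real n + L + 1) * (2 * real n + L + 1 + \<sigma>)
        * hyp32_normalized L d \<sigma> (Suc n)
      = \<sigma> * ((real n + L) * (real n + d) / (2 * real n + L + 1)
               + real n * (real n + L - d) / (2 * real n + L - 1)) * hyp32_normalized L d \<sigma> n
        + real n * (real n + L - d) / (2 * real n + L - 1) * (2 * real n + L - 1 - \<sigma>)
               * hyp32_normalized L d \<sigma> (n - 1)" if "n \<ge> 1" for n
    using hyp32_normalized_recurrence_real[OF that, of \<sigma>] poch[of n]
    unfolding of_real_eq_id id_apply by (simp only: of_nat_id simp_thms)
  note * = three_term_positive_bounds[of L d \<sigma> "hyp32_normalized L d \<sigma>" n,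
      OF L d \<sigma> hyp32_normalized_0 1 rec]
  show "hyp32_normalized L d \<sigma> n > 0" "hyp32_normalized L d \<sigma> (Suc n) < 1" using *(1,3) by simp_all
  have "2 * real n + L + 1 + \<sigma> > 0" using L \<sigma> by simp
  thus "hyp32_normalized L d \<sigma> (Suc n) \<ge> \<sigma> / (2 * real n + L + 1 + \<sigma>) * hyp32_normalized L d \<sigma> n"
    using *(2) by (simp add: pos_divide_le_eq mult.commute)
qed

text \<open>Induction by squeezing: the next term lies between the previous one times a factor
  tending to 1, and 1 itself.\<close>

lemma hyp32_normalized_tendsto_1:
  "((\<lambda>\<sigma>. hyp32_normalized L d \<sigma> n) \<longlongrightarrow> 1) at_top"
proof (induction n)
  case (Suc n)
  have "((\<lambda>\<sigma>. \<sigma> / (2 * real n + L + 1 + \<sigma>)) \<longlongrightarrow> 1) at_top" by real_asymp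
  from tendsto_mult[OF this Suc]
  have "((\<lambda>\<sigma>. \<sigma> / (2 * real n + L + 1 + \<sigma>) * hyp32_normalized L d \<sigma> n) \<longlongrightarrow> 1) at_top" by simp
  moreover note tendsto_const[of 1 at_top]
  moreover have "\<forall>\<^sub>F \<sigma> in at_top. \<sigma> / (2 * real n + L + 1 + \<sigma>) * hyp32_normalized L d \<sigma> n
      \<le> hyp32_normalized L d \<sigma> (Suc n)"
    using eventually_gt_at_top[of 0] by eventually_elim (rule hyp32_normalized_bounds)
  moreover have "\<forall>\<^sub>F \<sigma> in at_top. hyp32_normalized L d \<sigma> (Suc n) \<le> 1"
    using eventually_gt_at_top[of 0]
    by eventually_elim (rule less_imp_le[OF hyp32_normalized_bounds(3)])
  ultimately show ?case by (rule tendsto_sandwich[rotated 2])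
qed simp

text \<open>Multiplying by the Pochhammer symbol of the lower parameter gives \<open>H\<close>,
  whose recurrence has a middle coefficient odd in \<sigma> and outer coefficients even in \<sigma>.
  Hence \<open>H\<close> has the parity of \<open>n\<close>.\<close>

lemma hyp32_normalized_reflection:
  fixes \<sigma> :: "'a :: real_field"
  assumes "pochhammer ((\<sigma> + of_real L + 1) / 2) n \<noteq> 0" "pochhammer ((- \<sigma> + of_real L + 1) / 2) n \<noteq> 0"
  shows "pochhammer ((\<sigma> + of_real L + 1) / 2) n * hyp32_normalized (of_real L) (of_real d) \<sigma> n =
     (-1) ^ n * pochhammer ((- \<sigma> + of_real L + 1) / 2) n * hyp32_normalized (of_real L) (of_real d) (- \<sigma>) n"
proof -
  define D where "D = (\<lambda>(\<sigma> :: 'a) n. pochhammer ((\<sigma> + of_real L + 1) / 2) n)"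
  define H where "H = (\<lambda>\<sigma> n. D \<sigma> n * hyp32_normalized (of_real L) (of_real d) \<sigma> n)"
  define \<alpha> \<beta> where "\<alpha> = (\<lambda>n. (real n + L) * (real n + d) / (2 * real n + L + 1))"
    and "\<beta> = (\<lambda>n. real n * (real n + L - d) / (2 * real n + L - 1))"
  have D_Suc: "2 * D \<sigma> (Suc n) = D \<sigma> n * (2 * of_nat n + of_real L + 1 + \<sigma>)" for \<sigma> n
    by (simp add: D_def pochhammer_Suc field_simps)
  \<comment> \<open>Passing from \<open>D \<sigma> n\<close> to \<open>D \<sigma> (Suc n)\<close>
    absorbs the linear factor on the left, and passing from \<open>n - 1\<close> to \<open>n\<close>
    completes the factor of the last term to a difference of squares.\<close>
  have rec: "4 * of_real (\<alpha> n) * H \<sigma> (Suc n) = 2 * \<sigma> * of_real (\<alpha> n + \<beta> n) * H \<sigma> n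
      + of_real (\<beta> n) * ((2 * of_nat n + of_real L - 1)\<^sup>2 - \<sigma>\<^sup>2) * H \<sigma> (n - 1)"
    if n: "n \<ge> 1" and nz: "D \<sigma> (Suc n) \<noteq> 0" for n \<sigma>
  proof -
    let ?F = "hyp32_normalized (of_real L) (of_real d) \<sigma>"
    have D': "2 * D \<sigma> n = D \<sigma> (n - 1) * (2 * of_nat n + of_real L - 1 + \<sigma>)"
      using n D_Suc[of \<sigma> "n - 1"] by (simp add: of_nat_diff algebra_simps)
    have "4 * of_real (\<alpha> n) * H \<sigma> (Suc n) = 2 * of_real (\<alpha> n) * (2 * D \<sigma> (Suc n)) * ?F (Suc n)"
      by (simp add: H_def)
    also have "\<dots>
        = 2 * D \<sigma> n * (of_real (\<alpha> n) * (2 * of_nat n + of_real L + 1 + \<sigma>) * ?F (Suc n))"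
      unfolding D_Suc by (simp only: mult_ac)
    also have "of_real (\<alpha> n) * (2 * of_nat n + of_real L + 1 + \<sigma>) * ?F (Suc n)
      = \<sigma> * of_real (\<alpha> n + \<beta> n) * ?F n + of_real (\<beta> n) * (2 * of_nat n + of_real L - 1 - \<sigma>) * ?F (n - 1)"
      unfolding \<alpha>_def \<beta>_def using nz 
      by (intro hyp32_normalized_recurrence_real n) (simp add: D_def)
    also have "2 * D \<sigma> n * \<dots> = 2 * \<sigma> * of_real (\<alpha> n + \<beta> n) * H \<sigma> n
        + of_real (\<beta> n) * (2 * of_nat n + of_real L - 1 - \<sigma>) * (2 * D \<sigma> n) * ?F (n - 1)"
      by (simp add: H_def algebra_simps)
    also have "\<dots> = 2 * \<sigma> * of_real (\<alpha> n + \<beta> n) * H \<sigma> n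
      + of_real (\<beta> n) * ((2 * of_nat n + of_real L - 1)\<^sup>2 - \<sigma>\<^sup>2) * H \<sigma> (n - 1)"
      unfolding D' square_diff_square_factored power2_eq_square by (simp only: H_def mult_ac)
    finally show ?thesis .
  qed
  have "H \<sigma> n = (-1) ^ n * H (- \<sigma>) n" if "D \<sigma> n \<noteq> 0" "D (- \<sigma>) n \<noteq> 0"
    using that
  proof (induction n rule: less_induct)
    case (less n)
    consider "n = 0" | "n = 1" | m where "n = Suc (Suc m)"
      by (metis One_nat_def not0_implies_Suc)
    thus ?case
    proof cases
      case 1
      thus ?thesis by (simp add: H_def D_def)
    next
      case 2
      have H1: "H \<tau> (Suc 0) = \<tau> / 2" if "D \<tau> n \<noteq> 0" for \<tau>
        using that hyp32_normalized_1_real[of \<tau>] 2 by (simp add: H_def D_def field_simps)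
      show ?thesis using H1[OF less.prems(1)] H1[OF less.prems(2)] unfolding 2 by simp
    next
      case 3
      have nz: "D \<sigma> k \<noteq> 0" "D (- \<sigma>) k \<noteq> 0" if "k \<le> n" for k
        using less.prems pochhammer_neq_0_mono that unfolding D_def by blast+
      have IH: "H \<sigma> (Suc m) = (-1) ^ Suc m * H (- \<sigma>) (Suc m)" "H \<sigma> m = (-1) ^ m * H (- \<sigma>) m"
        using less.IH nz 3 by auto
      have "\<alpha> (Suc m) \<noteq> 0" using L d by (auto simp: \<alpha>_def)
      hence \<alpha>: "4 * of_real (\<alpha> (Suc m)) \<noteq> (0 :: 'a)" by simp
      define c b X :: 'a where "c = of_real (\<alpha> (Suc m) + \<beta> (Suc m))" and "b = of_real (\<beta> (Suc m))"
        and "X = 2 * of_nat (Suc m) + of_real L - 1"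
      have rec': "4 * of_real (\<alpha> (Suc m)) * H \<tau> n = 2 * \<tau> * c * H \<tau> (Suc m) + b * (X\<^sup>2 - \<tau>\<^sup>2) * H \<tau> m"
        if "D \<tau> n \<noteq> 0" for \<tau>
        using rec[of "Suc m" \<tau>] that by (simp only: 3 c_def b_def X_def diff_Suc_1) simp
      have "4 * of_real (\<alpha> (Suc m)) * H \<sigma> n
          = (-1) ^ n * (2 * (- \<sigma>) * c * H (- \<sigma>) (Suc m) + b * (X\<^sup>2 - (- \<sigma>)\<^sup>2) * H (- \<sigma>) m)"
        unfolding rec'[OF less.prems(1)] IH by (simp add: 3 algebra_simps)
      also have "\<dots> = (-1) ^ n * (4 * of_real (\<alpha> (Suc m)) * H (- \<sigma>) n)"
        unfolding rec'[OF less.prems(2)] ..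
      finally have "4 * of_real (\<alpha> (Suc m)) * H \<sigma> n
          = 4 * of_real (\<alpha> (Suc m)) * ((-1) ^ n * H (- \<sigma>) n)" by (simp only: mult_ac)
      thus ?thesis using \<alpha> mult_left_cancel by blast
    qed
  qed
  thus ?thesis using assms by (simp add: H_def D_def mult.assoc)
qed

end

subsection \<open>The polynomials as hypergeometric series\<close>

lemma gchoose_add_of_nat:
  "(of_nat r + x :: 'a::field_char_0) gchoose r = pochhammer (x + 1) r / fact r"
  by (simp add: gbinomial_pochhammer')

lemma gchoose_add_of_nat':
  "(x + of_nat r :: 'a::field_char_0) gchoose r = pochhammer (x + 1) r / fact r"
  by (simp add: gbinomial_pochhammer')

lemma minus_one_power_diff:
  "r \<le> m \<Longrightarrow> (-1) ^ (m - r) = (-1 :: 'a::comm_ring_1) ^ m * (-1) ^ r"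
  by (metis (no_types, lifting) minus_one_mult_self le_add_diff_inverse2 mult.assoc mult_1_right power_add)

lemma pochhammer_minus_of_nat:
  assumes "r \<le> m"
  shows "pochhammer (- of_nat m :: 'a::field_char_0) r = (-1) ^ r * fact m / fact (m - r)"
proof -
  have "of_nat (m choose r) = (-1) ^ r * pochhammer (- of_nat m :: 'a) r / fact r"
    by (simp add: binomial_gbinomial gbinomial_pochhammer)
  thus ?thesis using assms by (simp add: binomial_fact field_simps)
qed

text \<open>The duplication formula for both parities at once; it is the source of the lower
  parameter \<open>1 / 2 + of_nat \<epsilon>\<close> of the series.\<close>

lemma fact_double_plus:
  assumes "\<epsilon> \<le> 1"
  shows "fact (2 * r + \<epsilon>) = (4 ^ r * pochhammer (1 / 2 + of_nat \<epsilon>) r * fact r :: 'a::field_char_0)"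
proof (cases "\<epsilon> = 0")
  case True
  thus ?thesis using fact_double[of r, where ?'a = 'a] by (simp add: power_mult)
next
  case False
  have "pochhammer (1 / 2 :: 'a) (Suc r) = 1 / 2 * pochhammer (1 / 2 + 1) r" by (rule pochhammer_rec)
  hence "pochhammer (1 / 2 + 1 :: 'a) r = 2 * (pochhammer (1 / 2) r * (1 / 2 + of_nat r))"
    by (simp only: pochhammer_Suc) simp
  hence "pochhammer (1 / 2 + 1 :: 'a) r = pochhammer (1 / 2) r * (2 * of_nat r + 1)"
    by (simp add: algebra_simps)
  moreover have "\<epsilon> = 1" using assms False by simp
  moreover have "fact (2 * r) = (4 ^ r * pochhammer (1 / 2) r * fact r :: 'a)"
    using fact_double[of r, where ?'a = 'a] by (simp add: power_mult)
  ultimately show ?thesis by (simp add: algebra_simps)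
qed

lemma eps_le: "eps n \<le> 1" and eps_div: "2 * (n div 2) + eps n = n"
  by (auto simp: eps_def)

text \<open>A Pochhammer symbol contains every shorter one as a factor, so only the longest needs to
  be nonzero.\<close>

lemma no_pole_iff: 
  "no_pole lam n s \<longleftrightarrow> pochhammer ((s + of_real lam + of_nat (eps n)) / 2 + 1 / 4) (n div 2) \<noteq> 0"
proof -
  have "no_pole lam n s \<longleftrightarrow> (\<forall>r\<le>n div 2. pochhammer ((s + of_real lam + of_nat (eps n)) / 2 + 1 / 4) r \<noteq> 0)"
    unfolding no_pole_def gchoose_add_of_nat' by (simp add: add_ac)
  thus ?thesis using pochhammer_neq_0_mono by blast
qed

text \<open>A division-free form in \<open>s\<close>, uniform in the parity of \<open>n\<close> and
  valid also at the poles of \<open>q\<close>. The polynomial nature of \<open>p\<close> is read off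
  from it, and its summands are those that the Beta integrals produce.\<close>

lemma p_eq_sum:
  fixes lam :: real and n :: nat and s :: complex
  defines "m \<equiv> n div 2" and "e \<equiv> (s + of_real lam + of_nat (eps n)) / 2 + 1 / 4"
  shows "p lam n s = fact n / 2 * (\<Sum>r\<le>m. (-1) ^ (m - r) * 2 ^ (2 * r + eps n)
     * pochhammer (of_real lam) (m + r + eps n) / (fact (2 * r + eps n) * fact (m - r))
     * pochhammer ((s + of_nat (eps n)) / 2) r * pochhammer (e + of_nat r) (m - r))"
proof (cases "even n")
  case True
  hence n: "n = 2 * m" "eps n = 0" by (auto simp: m_def eps_def)
  have "p lam n s = p_even lam m s" using True by (simp add: p_def m_def)
  also have "\<dots> = fact n / 2 * (\<Sum>r=0..m. (-1) ^ (m - r) * 2 ^ (2 * r)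
     * pochhammer (of_real lam) (m + r) / (fact (2 * r) * fact (m - r))
     * pochhammer (s / 2) r * pochhammer (e + of_nat r) (m - r))"
    unfolding p_even_def sum_distrib_left
  proof (intro sum.cong refl)
    fix r assume "r \<in> {0..m}"
    hence r: "r \<le> m" by simp
    have "(of_nat m + of_nat r + of_real lam - 1 :: complex) gchoose (m + r)
        = of_nat (m + r) + (of_real lam - 1) gchoose (m + r)" by (simp add: algebra_simps)
    also have "\<dots> = pochhammer (of_real lam) (m + r) / fact (m + r)"
      unfolding gchoose_add_of_nat by simp
    finally have 1: "(of_nat m + of_nat r + of_real lam - 1 :: complex) gchoose (m + r)
        = pochhammer (of_real lam) (m + r) / fact (m + r)" .
    have 2: "((s - 2) / 2 + of_nat r gchoose r) = pochhammer (s / 2) r / fact r"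
      unfolding gchoose_add_of_nat' by (simp add: field_simps)
    have "(of_nat m + (s + of_real lam) / 2 - 3 / 4 gchoose (m - r))
        = (of_nat (m - r) + (of_nat r + (s + of_real lam) / 2 - 3 / 4) gchoose (m - r))"
      using r by (simp add: of_nat_diff algebra_simps)
    also have "\<dots> = pochhammer (e + of_nat r) (m - r) / fact (m - r)"
      unfolding gchoose_add_of_nat by (simp add: e_def n(2) algebra_simps)
    finally have 3: "(of_nat m + (s + of_real lam) / 2 - 3 / 4 gchoose (m - r))
        = pochhammer (e + of_nat r) (m - r) / fact (m - r)" .
    have 4: "(2 :: complex) powi (2 * int r - 1) = 2 ^ (2 * r) / 2"
      by (simp add: power_int_diff flip: power_int_of_nat)
    have 5: "of_nat ((m + r) choose (2 * r)) = (fact (m + r) / (fact (2 * r) * fact (m - r)) :: complex)"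
      using r by (subst binomial_fact) auto
    have 6: "of_nat (m choose r) = (fact m / (fact r * fact (m - r)) :: complex)"
      using r by (subst binomial_fact) auto
    show "fact m * fact (2 * m) * ((- 1) ^ (m - r) * 2 powi (2 * int r - 1)
         * (of_nat m + of_nat r + of_real lam - 1 gchoose (m + r))
         * of_nat (m + r choose (2 * r)) * ((s - 2) / 2 + of_nat r gchoose r)
         * (of_nat m + (s + of_real lam) / 2 - 3 / 4 gchoose (m - r)) / of_nat (m choose r)) =
      fact n / 2 * ((- 1) ^ (m - r) * 2 ^ (2 * r) * pochhammer (of_real lam) (m + r)
         / (fact (2 * r) * fact (m - r)) * pochhammer (s / 2) r * pochhammer (e + of_nat r) (m - r))"
      unfolding 1 2 3 4 5 6 n(1) by (simp add: field_simps)
  qed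
  finally show ?thesis by (simp add: n(2) atLeast0AtMost)
next
  case False
  hence n: "n = 2 * m + 1" "eps n = 1" by (auto simp: m_def eps_def)
  have "p lam n s = p_odd lam m s" using False by (simp add: p_def m_def)
  also have "\<dots> = fact n / 2 * (\<Sum>r=0..m. (-1) ^ (m - r) * 2 ^ (2 * r + 1)
     * pochhammer (of_real lam) (m + r + 1) / (fact (2 * r + 1) * fact (m - r))
     * pochhammer ((s + 1) / 2) r * pochhammer (e + of_nat r) (m - r))"
    unfolding p_odd_def sum_distrib_left
  proof (intro sum.cong refl)
    fix r assume "r \<in> {0..m}"
    hence r: "r \<le> m" by simp
    have "(of_nat m + of_nat r + of_real lam :: complex) gchoose (m + r + 1)
        = of_nat (m + r + 1) + (of_real lam - 1) gchoose (m + r + 1)" by (simp add: algebra_simps)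
    also have "\<dots> = pochhammer (of_real lam) (m + r + 1) / fact (m + r + 1)"
      unfolding gchoose_add_of_nat by simp
    finally have 1: "(of_nat m + of_nat r + of_real lam :: complex) gchoose (m + r + 1)
        = pochhammer (of_real lam) (m + r + 1) / fact (m + r + 1)" .
    have 2: "((s - 1) / 2 + of_nat r gchoose r) = pochhammer ((s + 1) / 2) r / fact r"
      unfolding gchoose_add_of_nat' by (simp add: field_simps)
    have "(of_nat m + (s + 1 + of_real lam) / 2 - 3 / 4 gchoose (m - r))
        = (of_nat (m - r) + (of_nat r + (s + 1 + of_real lam) / 2 - 3 / 4) gchoose (m - r))"
      using r by (simp add: of_nat_diff algebra_simps)
    also have "\<dots> = pochhammer (e + of_nat r) (m - r) / fact (m - r)"
      unfolding gchoose_add_of_nat by (simp add: e_def n(2) algebra_simps)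
    finally have 3: "(of_nat m + (s + 1 + of_real lam) / 2 - 3 / 4 gchoose (m - r))
        = pochhammer (e + of_nat r) (m - r) / fact (m - r)" .
    have 5: "of_nat ((m + r + 1) choose (2 * r + 1))
        = (fact (m + r + 1) / (fact (2 * r + 1) * fact (m - r)) :: complex)"
      using r by (subst binomial_fact) auto
    have 6: "of_nat (m choose r) = (fact m / (fact r * fact (m - r)) :: complex)"
      using r by (subst binomial_fact) auto
    show "fact m * fact (2 * m + 1) * ((- 1) ^ (m - r) * 2 ^ (2 * r)
         * (of_nat m + of_nat r + of_real lam gchoose (m + r + 1))
         * of_nat (m + r + 1 choose (2 * r + 1)) * ((s - 1) / 2 + of_nat r gchoose r)
         * (of_nat m + (s + 1 + of_real lam) / 2 - 3 / 4 gchoose (m - r)) / of_nat (m choose r)) =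
      fact n / 2 * ((- 1) ^ (m - r) * 2 ^ (2 * r + 1) * pochhammer (of_real lam) (m + r + 1)
         / (fact (2 * r + 1) * fact (m - r)) * pochhammer ((s + 1) / 2) r * pochhammer (e + of_nat r) (m - r))"
      unfolding 1 2 3 5 6 n(1) using fact_nonzero[of "m + r + 1", where ?'a = complex]
      by (simp add: divide_simps del: fact_Suc)
  qed
  finally show ?thesis by (simp add: n(2) atLeast0AtMost)
qed

text \<open>Off the poles, \<open>pochhammer (e + of_nat r) (m - r)\<close> is the quotient of
  \<open>pochhammer e m\<close> by \<open>pochhammer e r\<close>. The remaining factors are sorted
  by the duplication formula and by splitting the symbol in \<open>lam\<close>.\<close>

lemma p_eq_hyp32:
  fixes lam :: real and n :: nat and s :: complex
  defines "m \<equiv> n div 2" and "e \<equiv> (s + of_real lam + of_nat (eps n)) / 2 + 1 / 4"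
  assumes "no_pole lam n s"
  shows "p lam n s = (-1) ^ m * 2 ^ eps n / 2 * fact n / fact m * pochhammer (of_real lam) (m + eps n)
     * pochhammer e m * hyp32 (of_real lam + of_nat (eps n)) (1 / 2 + of_nat (eps n))
                          ((s + of_nat (eps n)) / 2) e m"
proof -
  have e: "pochhammer e m \<noteq> 0" using assms by (simp add: no_pole_iff)
  show ?thesis
    unfolding p_eq_sum hyp32_def sum_distrib_left m_def[symmetric] e_def[symmetric]
  proof (intro sum.cong refl)
    fix r assume "r \<in> {..m}"
    hence r: "r \<le> m" by simp
    have er: "pochhammer e r \<noteq> 0" using pochhammer_neq_0_mono[OF e r] .
    have 1: "pochhammer (e + of_nat r) (m - r) = pochhammer e m / pochhammer e r"
      using pochhammer_product[OF r, of e] er by simp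
    have 2: "pochhammer (of_real lam :: complex) (m + r + eps n) = pochhammer (of_real lam) (m + eps n)
        * pochhammer (of_nat m + (of_real lam + of_nat (eps n))) r"
      using pochhammer_product'[of "of_real lam :: complex" "m + eps n" r] by (simp add: add_ac)
    have 3: "2 ^ (2 * r + eps n) = (4 ^ r * 2 ^ eps n :: complex)"
      by (simp add: power_add power_mult)
    have 4: "pochhammer (1 / 2 + of_nat (eps n)) r \<noteq> (0 :: complex)"
      using fact_double_plus[OF eps_le, of r n, where ?'a = complex] fact_nonzero[of "2 * r + eps n", where ?'a = complex]
      by auto
    show "fact n / 2 * ((- 1) ^ (m - r) * 2 ^ (2 * r + eps n) *
          pochhammer (of_real lam) (m + r + eps n) / (fact (2 * r + eps n) * fact (m - r)) *
          pochhammer ((s + of_nat (eps n)) / 2) r * pochhammer (e + of_nat r) (m - r)) =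
         (- 1) ^ m * 2 ^ eps n / 2 * fact n / fact m * pochhammer (of_real lam) (m + eps n) *
          pochhammer e m * (pochhammer (- of_nat m) r *
           pochhammer (of_nat m + (of_real lam + of_nat (eps n))) r *
           pochhammer ((s + of_nat (eps n)) / 2) r /
           (pochhammer (1 / 2 + of_nat (eps n)) r * pochhammer e r * fact r))"
      unfolding 1 2 3 minus_one_power_diff[OF r] pochhammer_minus_of_nat[OF r] fact_double_plus[OF eps_le]
      using er 4 by (simp add: divide_simps)
  qed
qed

text \<open>Holds at every \<open>s\<close>: in each summand both sides divide by the same
  Pochhammer symbol up to nonzero constants, so they agree, both being 0, even where it
  vanishes.\<close>

lemma S32_even_eq_hyp32:
  "S32_even lam m s = (-1) ^ m / 2 * hyp32 (of_real lam) (1 / 2) (s / 2) ((s + of_real lam) / 2 + 1 / 4) m"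
  unfolding S32_even_def hyp32_def sum_distrib_left atLeast0AtMost
proof (intro sum.cong refl)
  fix r assume "r \<in> {..m}"
  hence r: "r \<le> m" by simp
  define e where "e = (s + of_real lam) / 2 + 1 / 4"
  have "(of_nat m + of_nat r + of_real lam - 1 :: complex) gchoose r
      = of_nat r + (of_nat m + of_real lam - 1) gchoose r" by (simp add: algebra_simps)
  also have "\<dots> = pochhammer (of_nat m + of_real lam) r / fact r"
    unfolding gchoose_add_of_nat by simp
  finally have 1: "(of_nat m + of_nat r + of_real lam - 1 :: complex) gchoose r
      = pochhammer (of_nat m + of_real lam) r / fact r" .
  have 2: "((s - 2) / 2 + of_nat r gchoose r) = pochhammer (s / 2) r / fact r"
    unfolding gchoose_add_of_nat' by (simp add: field_simps)
  have 3: "((s + of_real lam) / 2 - 3 / 4 + of_nat r gchoose r) = pochhammer e r / fact r"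
    unfolding gchoose_add_of_nat' by (simp add: e_def add_ac)
  have 4: "(2 :: complex) powi (2 * int r - 1) = 4 ^ r / 2"
    using power_int_of_nat[of "2 :: complex" "2 * r"] by (simp add: power_int_diff power_mult)
  have 5: "of_nat ((m + r) choose (2 * r))
      = (fact (m + r) / ((4 ^ r * pochhammer (1 / 2) r * fact r) * fact (m - r)) :: complex)"
    using r fact_double_plus[of 0 r, where ?'a = complex] by (subst binomial_fact) auto
  have 6: "of_nat ((m + r) choose r) = (fact (m + r) / (fact r * fact m) :: complex)"
    using r by (subst binomial_fact) auto
  show "(- 1) ^ (m - r) * 2 powi (2 * int r - 1)
       * (of_nat m + of_nat r + of_real lam - 1 gchoose r)
       * of_nat (m + r choose (2 * r)) * ((s - 2) / 2 + of_nat r gchoose r)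
       / (of_nat (m + r choose r) * ((s + of_real lam) / 2 - 3 / 4 + of_nat r gchoose r)) =
    (- 1) ^ m / 2 * (pochhammer (- of_nat m) r * pochhammer (of_nat m + of_real lam) r * pochhammer (s / 2) r
       / (pochhammer (1 / 2) r * pochhammer ((s + of_real lam) / 2 + 1 / 4) r * fact r))"
    unfolding 1 2 3 4 5 6 e_def[symmetric] minus_one_power_diff[OF r] pochhammer_minus_of_nat[OF r]
    by (simp add: divide_simps)
qed

text \<open>As in the even case; the factor \<open>m + 1\<close> comes from the
  \<open>(m + 1)!\<close> in the denominator of \<open>(m + r + 1) choose r\<close>.\<close>

lemma S32_odd_eq_hyp32:
  "S32_odd lam m s = of_nat (m + 1) * (-1) ^ m
     * hyp32 (of_real lam + 1) (3 / 2) ((s + 1) / 2) ((s + of_real lam) / 2 + 3 / 4) m"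
  unfolding S32_odd_def hyp32_def sum_distrib_left atLeast0AtMost
proof (intro sum.cong refl)
  fix r assume "r \<in> {..m}"
  hence r: "r \<le> m" by simp
  define e where "e = (s + of_real lam) / 2 + 3 / 4"
  have "(of_nat m + of_nat r + of_real lam :: complex) gchoose r
      = of_nat r + (of_nat m + of_real lam) gchoose r" by (simp add: algebra_simps)
  also have "\<dots> = pochhammer (of_nat m + (of_real lam + 1)) r / fact r"
    unfolding gchoose_add_of_nat by (simp add: add_ac)
  finally have 1: "(of_nat m + of_nat r + of_real lam :: complex) gchoose r
      = pochhammer (of_nat m + (of_real lam + 1)) r / fact r" .
  have 2: "((s - 1) / 2 + of_nat r gchoose r) = pochhammer ((s + 1) / 2) r / fact r"
    unfolding gchoose_add_of_nat' by (simp add: field_simps)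
  have 3: "((s + of_real lam) / 2 - 1 / 4 + of_nat r gchoose r) = pochhammer e r / fact r"
    unfolding gchoose_add_of_nat' by (simp add: e_def add_ac)
  have 4: "(2 :: complex) ^ (2 * r) = 4 ^ r" by (simp add: power_mult)
  have 5: "of_nat ((m + r + 1) choose (2 * r + 1))
      = (fact (m + r + 1) / ((4 ^ r * pochhammer (3 / 2) r * fact r) * fact (m - r)) :: complex)"
    using r fact_double_plus[of 1 r, where ?'a = complex] by (subst binomial_fact) (auto simp del: fact_Suc)
  have 6: "of_nat ((m + r + 1) choose r) = (fact (m + r + 1) / (fact r * (of_nat (m + 1) * fact m)) :: complex)"
    using r by (subst binomial_fact) (auto simp: Suc_diff_le)
  have 7: "fact (m + r + 1) \<noteq> (0 :: complex)" "of_nat (m + 1) \<noteq> (0 :: complex)"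
    by (simp_all only: fact_nonzero of_nat_eq_0_iff) simp_all
  show "(- 1) ^ (m - r) * 2 ^ (2 * r)
       * (of_nat m + of_nat r + of_real lam gchoose r)
       * of_nat (m + r + 1 choose (2 * r + 1)) * ((s - 1) / 2 + of_nat r gchoose r)
       / (of_nat (m + r + 1 choose r) * ((s + of_real lam) / 2 - 1 / 4 + of_nat r gchoose r)) =
    of_nat (m + 1) * (- 1) ^ m * (pochhammer (- of_nat m) r * pochhammer (of_nat m + (of_real lam + 1)) r
       * pochhammer ((s + 1) / 2) r
       / (pochhammer (3 / 2) r * pochhammer ((s + of_real lam) / 2 + 3 / 4) r * fact r))"
    unfolding 1 2 3 4 5 6 e_def[symmetric] minus_one_power_diff[OF r] pochhammer_minus_of_nat[OF r]
    using 7 by (simp add: divide_simps del: fact_Suc of_nat_Suc of_nat_add)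
qed

lemma p_even_S32:
  assumes "no_pole lam (2 * n) s"
  shows "p lam (2 * n) s = fact n * fact (2 * n) * (of_nat n + of_real lam - 1 gchoose n)
            * (of_nat n + (s + of_real lam) / 2 - 3 / 4 gchoose n) * S32_even lam n s"
proof -
  have 1: "(of_nat n + of_real lam - 1 :: complex) gchoose n = pochhammer (of_real lam) n / fact n"
    using gchoose_add_of_nat[of n "of_real lam - 1 :: complex"] by (simp add: algebra_simps)
  have 2: "(of_nat n + (s + of_real lam) / 2 - 3 / 4 gchoose n)
      = pochhammer ((s + of_real lam) / 2 + 1 / 4) n / fact n"
    using gchoose_add_of_nat[of n "(s + of_real lam) / 2 - 3 / 4"] by (simp add: algebra_simps)
  show ?thesis
    unfolding p_eq_hyp32[OF assms] S32_even_eq_hyp32 1 2 by (simp add: eps_def field_simps)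
qed

lemma p_odd_S32:
  assumes "no_pole lam (2 * n + 1) s"
  shows "p lam (2 * n + 1) s = fact n * fact (2 * n + 1) * (of_nat n + of_real lam gchoose (n + 1))
            * (of_nat n + (s + of_real lam) / 2 - 1 / 4 gchoose n) * S32_odd lam n s"
proof -
  have 1: "(of_nat n + of_real lam :: complex) gchoose (n + 1)
      = pochhammer (of_real lam) (n + 1) / (of_nat (n + 1) * fact n)"
    using gchoose_add_of_nat[of "n + 1" "of_real lam - 1 :: complex"] by (simp add: algebra_simps)
  have e: "(s + of_real lam + 1) / 2 + 1 / 4 = (s + of_real lam) / 2 + 3 / 4"
    by (simp add: field_simps)
  have 2: "(of_nat n + (s + of_real lam) / 2 - 1 / 4 gchoose n)
      = pochhammer ((s + of_real lam) / 2 + 3 / 4) n / fact n"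
    using gchoose_add_of_nat[of n "(s + of_real lam) / 2 - 1 / 4"] by (simp add: algebra_simps)
  have 3: "of_nat (n + 1) \<noteq> (0 :: complex)" by (simp only: of_nat_eq_0_iff)
  have eps: "eps (2 * n + 1) = 1" "(2 * n + 1) div 2 = n" by (simp_all add: eps_def)
  show ?thesis
    unfolding p_eq_hyp32[OF assms] S32_odd_eq_hyp32 1 2 eps of_nat_1 e using 3
    by (simp add: divide_simps del: fact_Suc of_nat_Suc of_nat_add pochhammer_Suc)
qed

section \<open>Binomials read through Gamma, and the relation between \<open>q\<close> and
  \<open>p\<close>\<close>

lemma Gbinom_of_nat:
  assumes "x + 1 \<notin> \<int>\<^sub>\<le>\<^sub>0"
  shows "Gbinom (x + of_nat k) (of_nat k) = pochhammer (x + 1) k / fact k"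
  using assms by (simp add: Gbinom_def pochhammer_Gamma add_ac flip: Gamma_fact)

text \<open>The condition on \<open>lam\<close> keeps \<open>2 * lam + 1\<close> off the poles of
  Gamma. The factor \<open>lam\<close> in the definition of \<open>q\<close> then supplies the
  missing first factor of a Pochhammer symbol starting at \<open>2 * lam\<close>.\<close>

lemma mult_Gbinom:
  assumes "lam > - 1 / 2"
  shows "of_real lam * Gbinom (2 * of_real lam + of_nat k) (of_nat k)
           = pochhammer (2 * of_real lam) (Suc k) / (2 * fact k)"
proof -
  have "2 * of_real lam + 1 \<notin> (\<int>\<^sub>\<le>\<^sub>0 :: complex set)"
  proof
    assume "2 * of_real lam + 1 \<in> (\<int>\<^sub>\<le>\<^sub>0 :: complex set)"
    then obtain j where "2 * of_real lam + 1 = (- of_nat j :: complex)" by (elim nonpos_Ints_cases')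
    hence "Re (2 * of_real lam + 1) = Re (- of_nat j)" by simp
    thus False using assms by simp
  qed
  from Gbinom_of_nat[OF this, of k] show ?thesis by (simp add: pochhammer_rec)
qed

lemma q_den_eq:
  "q_den lam n s = 4 ^ (n div 2) * pochhammer ((s + of_real lam + of_nat (eps n)) / 2 + 1 / 4) (n div 2)"
proof -
  have *: "(\<Prod>j=1..m. 4 * (x + of_nat j)) = 4 ^ m * pochhammer (x + 1) m" for x :: complex and m
    by (induction m) (simp_all add: pochhammer_Suc algebra_simps)
  have "q_den lam n s = (\<Prod>j=1..n div 2. 4 * ((s + of_real lam + of_nat (eps n)) / 2 - 3 / 4 + of_nat j))"
    unfolding q_den_def eps_def by (cases "even n") (auto intro!: prod.cong simp: field_simps)
  thus ?thesis unfolding * by (simp add: add_ac)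
qed

lemma q_den_eq_0_iff: "q_den lam n s = 0 \<longleftrightarrow> \<not> no_pole lam n s"
  by (simp add: q_den_eq no_pole_iff)

text \<open>Divides the S:3/2 form of \<open>p\<close> by its binomial in \<open>s\<close>, which is
  nonzero off the poles, using that \<open>fact n\<close> is \<open>n\<close> times
  \<open>fact (n - 1)\<close>.\<close>

lemma q_even_eq_p:
  assumes "n \<ge> 1" "no_pole lam (2 * n) s"
  shows "q lam (2 * n) s = 2 * p lam (2 * n) s
            / (of_real lam * fact (n - 1) * fact (2 * n)
               * Gbinom (2 * of_nat n + 2 * of_real lam - 1) (2 * of_nat n - 1)
               * (of_nat n + (s + of_real lam) / 2 - 3 / 4 gchoose n))"
proof -
  have "((s + of_real lam + of_nat (eps (2 * n))) / 2 - 3 / 4 + of_nat n gchoose n) \<noteq> 0"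
    using assms(2) unfolding no_pole_def by (metis nonzero_mult_div_cancel_left order_refl zero_neq_numeral)
  hence B: "(of_nat n + (s + of_real lam) / 2 - 3 / 4 gchoose n) \<noteq> 0"
    by (simp add: eps_def algebra_simps)
  have f: "fact n = (of_nat n * fact (n - 1) :: complex)"
    using assms(1) by (simp add: fact_reduce)
  define G :: complex where "G = Gbinom (2 * of_nat n + 2 * of_real lam - 1) (2 * of_nat n - 1)"
  show ?thesis unfolding p_even_S32[OF assms(2)] G_def[symmetric]
    using B by (simp add: q_def q_even_def G_def[symmetric] f divide_simps)
qed

lemma q_odd_eq_p:
  assumes "no_pole lam (2 * n + 1) s"
  shows "q lam (2 * n + 1) s = p lam (2 * n + 1) s
            / (of_real lam * fact n * fact (2 * n)
               * Gbinom (2 * of_nat n + 2 * of_real lam) (2 * of_nat n)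
               * (of_nat n + (s + of_real lam) / 2 - 1 / 4 gchoose n))"
proof -
  have "((s + of_real lam + of_nat (eps (2 * n + 1))) / 2 - 3 / 4 + of_nat n gchoose n) \<noteq> 0"
    using assms unfolding no_pole_def by (metis div_mult_self4 One_nat_def Suc_eq_plus1 even_Suc_div_two dvd_triv_left nonzero_mult_div_cancel_left order_refl zero_neq_numeral)
  moreover have "(s + of_real lam + of_nat (eps (2 * n + 1))) / 2 - 3 / 4 + of_nat n
      = of_nat n + (s + of_real lam) / 2 - 1 / 4" by (simp add: eps_def field_simps)
  ultimately have "(of_nat n + (s + of_real lam) / 2 - 1 / 4 gchoose n) \<noteq> 0" by metis
  thus ?thesis unfolding p_odd_S32[OF assms]
    by (simp add: q_def q_odd_def divide_simps)
qed

lemma q_eq_p: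
  assumes lam: "lam > - 1 / 2" and n: "n \<ge> 1" and np: "no_pole lam n s"
  shows "q lam n s = 2 ^ (2 * (n div 2) + 1) * p lam n s / (pochhammer (2 * of_real lam) n * q_den lam n s)"
proof (cases "even n")
  case True
  define m where "m = n div 2"
  have n_eq: "n = 2 * m" using True by (simp add: m_def)
  \<comment> \<open>Writing \<open>m\<close> as a successor makes the lower entry
    \<open>2m - 1\<close> a natural number, as the evaluation of the Gamma binomial
    requires.\<close>
  then obtain k where k: "m = Suc k" using n by (cases m) auto
  let ?b = "of_nat m + (s + of_real lam) / 2 - 3 / 4 gchoose m"
  have eq: "2 * of_nat m + 2 * of_real lam - 1 = 2 * of_real lam + (of_nat (Suc (2 * k)) :: complex)"
    "2 * of_nat m - 1 = (of_nat (Suc (2 * k)) :: complex)" by (simp_all add: k)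
  have G: "of_real lam * Gbinom (2 * of_nat m + 2 * of_real lam - 1) (2 * of_nat m - 1)
     = pochhammer (2 * of_real lam) n / (2 * fact (Suc (2 * k)))"
    unfolding eq mult_Gbinom[OF lam] by (simp add: n_eq k)
  have b: "?b = pochhammer ((s + of_real lam) / 2 + 1 / 4) m / fact m"
    using gchoose_add_of_nat[of m "(s + of_real lam) / 2 - 3 / 4"] by (simp add: algebra_simps)
  have den: "q_den lam n s = 4 ^ m * fact m * ?b"
    unfolding b q_den_eq by (simp add: n_eq eps_def)
  have f: "fact (2 * m) = (2 * of_nat m * fact (Suc (2 * k)) :: complex)" "fact m = (of_nat m * fact k :: complex)"
    by (simp_all add: k algebra_simps)
  have m0: "of_nat m \<noteq> (0::complex)" by (simp add: k del: of_nat_Suc)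
  have "q lam n s = 2 * p lam n s
            / ((of_real lam * Gbinom (2 * of_nat m + 2 * of_real lam - 1) (2 * of_nat m - 1))
               * fact (m - 1) * fact (2 * m) * ?b)"
    using q_even_eq_p[of m lam s] np k unfolding n_eq by (simp add: mult_ac)
  also have "\<dots> = 2 * 4 ^ m * p lam n s / (pochhammer (2 * of_real lam) n * (4 ^ m * fact m * ?b))"
    unfolding G f using m0 by (simp add: k divide_simps del: fact_Suc of_nat_Suc)
  finally show ?thesis unfolding den by (simp add: m_def power_mult)
next
  case False
  define m where "m = n div 2"
  have n_eq: "n = 2 * m + 1" using False by (simp add: m_def)
  let ?b = "of_nat m + (s + of_real lam) / 2 - 1 / 4 gchoose m"
  have G: "of_real lam * Gbinom (2 * of_nat m + 2 * of_real lam) (2 * of_nat m)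
     = pochhammer (2 * of_real lam) n / (2 * fact (2 * m))"
    using mult_Gbinom[OF lam, of "2 * m"] by (simp add: n_eq add_ac)
  have b: "?b = pochhammer ((s + of_real lam + 1) / 2 + 1 / 4) m / fact m"
  proof -
    have eq: "(s + of_real lam) / 2 - 1 / 4 + 1 = (s + of_real lam + 1) / 2 + 1 / 4"
      by (simp add: field_simps)
    show ?thesis
      using gchoose_add_of_nat[of m "(s + of_real lam) / 2 - 1 / 4"] by (simp only: eq add_diff_eq)
  qed
  have "eps n = 1" "n div 2 = m" by (simp_all add: n_eq eps_def)
  hence den: "q_den lam n s = 4 ^ m * fact m * ?b"
    unfolding b q_den_eq by simp
  have "q lam n s = p lam n s
            / ((of_real lam * Gbinom (2 * of_nat m + 2 * of_real lam) (2 * of_nat m))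
               * fact m * fact (2 * m) * ?b)"
    using q_odd_eq_p[of lam m s] np unfolding n_eq by (simp add: mult_ac)
  also have "\<dots> = 2 * 4 ^ m * p lam n s / (pochhammer (2 * of_real lam) n * (4 ^ m * fact m * ?b))"
    unfolding G by (simp add: divide_simps)
  finally show ?thesis unfolding den by (simp add: m_def power_mult)
qed

text \<open>Duplication for Pochhammer symbols in both parities; in odd length the extra factor
  \<open>2z + 2m\<close> lengthens the symbol at \<open>z\<close> by one.\<close>

lemma pochhammer_double_plus:
  fixes z :: "'a::field_char_0"
  assumes "\<epsilon> \<le> 1"
  shows "pochhammer (2 * z) (2 * m + \<epsilon>) = 2 ^ \<epsilon> * 4 ^ m * pochhammer z (m + \<epsilon>) * pochhammer (z + 1 / 2) m"
proof (cases "\<epsilon> = 0")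
  case True
  thus ?thesis by (simp add: pochhammer_double power_mult)
next
  case False
  hence "\<epsilon> = 1" using assms by simp
  have "pochhammer (2 * z) (2 * m + 1) = pochhammer (2 * z) (2 * m) * (2 * z + 2 * of_nat m)"
    by (simp add: pochhammer_Suc)
  also have "pochhammer (2 * z) (2 * m) = 4 ^ m * pochhammer z m * pochhammer (z + 1 / 2) m"
    by (simp add: pochhammer_double power_mult)
  finally show ?thesis unfolding \<open>\<epsilon> = 1\<close> by (simp add: pochhammer_Suc algebra_simps)
qed

text \<open>Here the lower parameter \<open>L - d + 1\<close> becomes \<open>1 / 2 + eps n\<close>,
  and the sign change of \<sigma> becomes the reflection of \<open>s\<close> into
  \<open>1 - s\<close>. The type is left general so that real bounds and complex identities concern
  the same series.\<close>

definition normalized_mellin :: "real \<Rightarrow> nat \<Rightarrow> 'a::real_field \<Rightarrow> 'a" where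
  "normalized_mellin lam n s = hyp32_normalized (of_real (lam + real (eps n))) (of_real (lam + 1 / 2)) (s - 1 / 2) (n div 2)"

text \<open>The two duplication formulas convert the prefactor of the hypergeometric form into
  \<open>pochhammer (2 * of_real lam) n / 2\<close> times the normalizing factor of the
  series.\<close>

lemma p_eq_normalized:
  assumes lam: "lam > - 1 / 2" and np: "no_pole lam n s"
  shows "p lam n s = pochhammer (2 * of_real lam) n / 2
     * pochhammer ((s + of_real lam + of_nat (eps n)) / 2 + 1 / 4) (n div 2) * normalized_mellin lam n s"
proof -
  define m \<epsilon> e where "m = n div 2" and "\<epsilon> = eps n" and "e = (s + of_real lam + of_nat \<epsilon>) / 2 + 1 / 4"
  let ?l = "of_real lam :: complex"
  let ?h = "hyp32 (?l + of_nat \<epsilon>) (1 / 2 + of_nat \<epsilon>) ((s + of_nat \<epsilon>) / 2) e m"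
  have \<epsilon>: "\<epsilon> \<le> 1" and n: "n = 2 * m + \<epsilon>" using eps_le eps_div by (simp_all add: \<epsilon>_def m_def)
  have g: "?l + of_nat \<epsilon> - (?l + 1 / 2) + 1 = 1 / 2 + of_nat \<epsilon>" by simp
  have e: "(s - 1 / 2 + (?l + of_nat \<epsilon>) + 1) / 2 = e" by (simp add: e_def field_simps)
  have f: "e - (?l + 1 / 2) / 2 = (s + of_nat \<epsilon>) / 2" by (simp add: e_def field_simps)
  have N: "normalized_mellin lam n s
      = (-1) ^ m * pochhammer (1 / 2 + of_nat \<epsilon>) m / pochhammer (?l + 1 / 2) m * ?h"
    unfolding normalized_mellin_def hyp32_normalized_def Let_def m_def[symmetric] \<epsilon>_def[symmetric]
      of_real_add of_real_of_nat_eq of_real_divide of_real_1 of_real_numeral g e f ..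
  have d: "pochhammer (?l + 1 / 2) m \<noteq> 0"
    using pochhammer_pos[of "lam + 1 / 2" m] lam pochhammer_of_real[of "lam + 1 / 2" m, where ?'a = complex] by auto
  have "fact n = (4 ^ m * pochhammer (1 / 2 + of_nat \<epsilon>) m * fact m :: complex)"
    unfolding n by (rule fact_double_plus[OF \<epsilon>])
  moreover have "pochhammer (2 * ?l) n = 2 ^ \<epsilon> * 4 ^ m * pochhammer ?l (m + \<epsilon>) * pochhammer (?l + 1 / 2) m"
    unfolding n by (rule pochhammer_double_plus[OF \<epsilon>])
  ultimately show ?thesis
    unfolding p_eq_hyp32[OF np] N m_def[symmetric] \<epsilon>_def[symmetric] e_def[symmetric]
    using d by (simp add: divide_simps)
qed

text \<open>Here \<open>lam \<noteq> 0\<close> enters: \<open>2 * lam\<close> exceeds -1, so 0 is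
  the only nonpositive integer it could equal.\<close>

lemma pochhammer_2_lam_nonzero:
  assumes "lam > - 1 / 2" "lam \<noteq> 0"
  shows "pochhammer (2 * complex_of_real lam) n \<noteq> 0"
proof -
  have "pochhammer (2 * lam) n \<noteq> 0"
  proof
    assume "pochhammer (2 * lam) n = 0"
    then obtain k where "2 * lam = - real k" by (auto simp: pochhammer_eq_0_iff)
    thus False using assms by (cases k) auto
  qed
  thus ?thesis using pochhammer_of_real[of "2 * lam" n, where ?'a = complex] by auto
qed

text \<open>The constants of \<open>q\<close> are exactly those that cancel the prefactor of
  \<open>p\<close>, so all bounds, the limit and the reflection of the series carry over to
  \<open>q\<close> unchanged.\<close>

lemma q_eq_normalized:
  assumes lam: "lam > - 1 / 2" "lam \<noteq> 0" and n: "n \<ge> 1" and np: "no_pole lam n s"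
  shows "q lam n s = normalized_mellin lam n s"
proof -
  have "pochhammer ((s + of_real lam + of_nat (eps n)) / 2 + 1 / 4) (n div 2) \<noteq> 0"
    using np by (simp add: no_pole_iff)
  thus ?thesis
    unfolding q_eq_p[OF lam(1) n np] p_eq_normalized[OF lam(1) np] q_den_eq
    using pochhammer_2_lam_nonzero[OF lam, of n] by (simp add: power_mult)
qed

text \<open>A pole would be a point \<open>s = - lam - eps n - 1/2 - 2k\<close>, whose real part is
  negative for \<open>lam > -1/2\<close>.\<close>

lemma no_pole_right_half_plane:
  assumes lam: "lam > - 1 / 2" and s: "Re s > 0"
  shows "no_pole lam n s"
  unfolding no_pole_iff pochhammer_eq_0_iff
proof safe
  fix k assume "(s + of_real lam + of_nat (eps n)) / 2 + 1 / 4 = - of_nat k"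
  hence "Re ((s + of_real lam + of_nat (eps n)) / 2 + 1 / 4) = - real k" by simp
  hence *: "(Re s + lam + real (eps n)) / 2 + 1 / 4 = - real k" by simp
  have "Re s + lam + real (eps n) > - (1 / 2)" using lam s by (simp add: add_pos_pos add_strict_increasing2 eps_def)
  moreover have "Re s + lam + real (eps n) = - (1 / 2) - 2 * real k"
    using * by (simp add: field_simps)
  ultimately show False by simp
qed

context
  fixes lam :: real and n :: nat
  assumes lam: "lam > - 1 / 2"
begin

lemma normalized_mellin_params:
  "lam + real (eps n) > -1" "lam + 1 / 2 > 0" "lam + 1 / 2 < lam + real (eps n) + 1"
  using lam by auto

text \<open>The strict upper bound starts at \<open>n = 2\<close>, since for smaller
  \<open>n\<close> the series is the constant 1.\<close>

lemma normalized_mellin_bounds: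
  fixes x :: real
  assumes "x > 1 / 2"
  shows "normalized_mellin lam n x > 0" and "n \<ge> 2 \<Longrightarrow> normalized_mellin lam n x < 1"
proof -
  note * = hyp32_normalized_bounds[OF normalized_mellin_params, of "x - 1 / 2"]
  show "normalized_mellin lam n x > 0" using *(1) assms by (simp add: normalized_mellin_def)
  assume "n \<ge> 2"
  then obtain m where "n div 2 = Suc m" by (cases "n div 2") auto
  thus "normalized_mellin lam n x < 1" using *(3) assms by (simp add: normalized_mellin_def)
qed

lemma normalized_mellin_of_real:
  "normalized_mellin lam n (of_real x) = (of_real (normalized_mellin lam n x) :: complex)"
  using hyp32_normalized_of_real[of "lam + real (eps n)" "lam + 1 / 2" "x - 1 / 2" "n div 2", where ?'a = complex]
  by (simp add: normalized_mellin_def)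

lemma normalized_mellin_tendsto_1: "((\<lambda>x::real. normalized_mellin lam n x) \<longlongrightarrow> 1) at_top"
proof -
  have "filterlim (\<lambda>x::real. x - 1 / 2) at_top at_top" by real_asymp
  from filterlim_compose[OF hyp32_normalized_tendsto_1[OF normalized_mellin_params] this]
  show ?thesis by (simp add: normalized_mellin_def)
qed

lemma normalized_mellin_reflection:
  assumes "no_pole lam n s" "no_pole lam n (1 - s)"
  shows "pochhammer ((s + of_real lam + of_nat (eps n)) / 2 + 1 / 4) (n div 2) * normalized_mellin lam n s
     = (-1) ^ (n div 2) * pochhammer ((1 - s + of_real lam + of_nat (eps n)) / 2 + 1 / 4) (n div 2)
         * normalized_mellin lam n (1 - s)"
proof -
  let ?L = "of_real (lam + real (eps n)) :: complex"
  have 1: "(s - 1 / 2 + ?L + 1) / 2 = (s + of_real lam + of_nat (eps n)) / 2 + 1 / 4"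
    and 2: "(- (s - 1 / 2) + ?L + 1) / 2 = (1 - s + of_real lam + of_nat (eps n)) / 2 + 1 / 4"
    and 3: "1 - s - 1 / 2 = - (s - 1 / 2)" by (simp_all add: field_simps)
  show ?thesis
    using hyp32_normalized_reflection[OF normalized_mellin_params, where \<sigma> = "s - 1 / 2" and n = "n div 2"] assms
    unfolding 1 2 3 normalized_mellin_def no_pole_iff by blast
qed

end

section \<open>Polynomiality of \<open>p\<close> and its reflection\<close>

lemma ex_poly_pochhammer:
  "\<exists>Q. degree Q = k \<and> (\<forall>s. poly Q s = pochhammer (s / 2 + c) k)" for c :: complex
proof (intro exI conjI allI)
  let ?Q = "\<Prod>i<k. [:c + of_nat i, 1 / 2:]"
  show "degree ?Q = k" by (subst degree_prod_sum_eq) auto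
  show "poly ?Q s = pochhammer (s / 2 + c) k" for s
    by (simp add: poly_prod pochhammer_prod lessThan_atLeast0 add_ac)
qed

text \<open>Each summand is a product of polynomials of degrees \<open>r\<close> and
  \<open>m - r\<close>. Leading terms might cancel, so only an upper bound results here; the exact
  degree follows later from the limit of \<open>q\<close>.\<close>

lemma ex_poly_p: "\<exists>P. degree P \<le> n div 2 \<and> (\<forall>s. poly P s = p lam n s)"
proof -
  define m where "m = n div 2"
  have "\<exists>Q. degree Q = r \<and> (\<forall>s. poly Q s = pochhammer (s / 2 + of_nat (eps n) / 2 :: complex) r)" for r
    by (rule ex_poly_pochhammer)
  then obtain A where A: "\<And>r. degree (A r) = r"
    "\<And>r s. poly (A r) s = pochhammer (s / 2 + of_nat (eps n) / 2 :: complex) r"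
    by metis
  have "\<exists>Q. degree Q = m - r \<and> (\<forall>s. poly Q s
      = pochhammer (s / 2 + ((of_real lam + of_nat (eps n)) / 2 + 1 / 4 + of_nat r) :: complex) (m - r))" for r
    by (rule ex_poly_pochhammer)
  then obtain B where B: "\<And>r. degree (B r) = m - r"
    "\<And>r s. poly (B r) s = pochhammer (s / 2 + ((of_real lam + of_nat (eps n)) / 2 + 1 / 4 + of_nat r) :: complex) (m - r)"
    by metis
  define c :: "nat \<Rightarrow> complex" where "c = (\<lambda>r. (-1) ^ (m - r) * 2 ^ (2 * r + eps n)
     * pochhammer (of_real lam) (m + r + eps n) / (fact (2 * r + eps n) * fact (m - r)))"
  define P where "P = smult (fact n / 2) (\<Sum>r\<le>m. smult (c r) (A r * B r))"
  have "degree (A r * B r) \<le> m" if "r \<le> m" for r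
    using degree_mult_le[of "A r" "B r"] A(1)[of r] B(1)[of r] that by linarith
  hence "degree (\<Sum>r\<le>m. smult (c r) (A r * B r)) \<le> m"
    by (intro degree_sum_le) (auto intro: order_trans[OF degree_smult_le])
  hence "degree P \<le> m" unfolding P_def by (rule order_trans[OF degree_smult_le])
  moreover have "poly P s = p lam n s" for s
    unfolding p_eq_sum P_def c_def m_def[symmetric] poly_smult poly_sum poly_mult A B
    by (simp add: field_simps)
  ultimately show ?thesis unfolding m_def by blast
qed

text \<open>Both sides of the reflection of the series are values of \<open>p\<close> up to the same
  constant. For real \<open>s\<close> in (0,1) neither \<open>s\<close> nor \<open>1 - s\<close> is
  a pole, and infinitely many points determine a polynomial identity, which then covers the poles
  too.\<close>

lemma p_reflection:
  assumes lam: "lam > - 1 / 2"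
  shows "p lam n s = (-1) ^ (n div 2) * p lam n (1 - s)"
proof -
  obtain P where P: "\<And>s. poly P s = p lam n s" using ex_poly_p by blast
  define R where "R = P - smult ((-1) ^ (n div 2)) (pcompose P [:1, -1:])"
  have R: "poly R s = p lam n s - (-1) ^ (n div 2) * p lam n (1 - s)" for s
    by (simp add: R_def poly_pcompose P)
  have "poly R (of_real x) = 0" if "x \<in> {0<..<1}" for x :: real
  proof -
    have np: "no_pole lam n (of_real x)" "no_pole lam n (1 - of_real x)"
      using that by (auto intro!: no_pole_right_half_plane lam)
    show ?thesis
      using normalized_mellin_reflection[OF lam np]
      unfolding R p_eq_normalized[OF lam np(1)] p_eq_normalized[OF lam np(2)] by simp
  qed
  hence "of_real ` {0<..<1::real} \<subseteq> {s. poly R s = 0}" by auto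
  moreover have "infinite (complex_of_real ` {0<..<1::real})"
    by (subst finite_image_iff) (auto simp: inj_on_def)
  ultimately have "R = 0" using poly_roots_finite finite_subset by blast
  thus ?thesis using R[of s] by simp
qed

subsection \<open>Mellin transforms on the unit interval\<close>

lemma norm_of_real_powr_complex:
  "x > 0 \<Longrightarrow> norm (complex_of_real x powr (z - 1)) = x powr (Re z - 1)"
  by (simp add: norm_powr_real_powr)

text \<open>Over compact subintervals one may differentiate under the integral sign. The full
  integral is their limit, uniform on small closed balls because the tails are dominated by one real
  integral.\<close>

lemma holomorphic_mellin_unit_interval:
  fixes w :: "real \<Rightarrow> real"
  assumes w [measurable]: "w \<in> borel_measurable borel" and w_nonneg: "\<And>x. w x \<ge> 0"
    and cont: "continuous_on {0<..<1} w"
    and int: "\<And>a. a > 0 \<Longrightarrow> set_integrable lborel {0<..<1} (\<lambda>x. x powr (a - 1) * w x)"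
  shows "\<And>z. Re z > 0 \<Longrightarrow> set_integrable lborel {0<..<1} (\<lambda>x. of_real x powr (z - 1) * complex_of_real (w x))"
    and "(\<lambda>z. LINT x:{0<..<1}|lborel. of_real x powr (z - 1) * complex_of_real (w x)) holomorphic_on {z. Re z > 0}"
proof -
  define h where "h = (\<lambda>z x. of_real x powr (z - 1) * complex_of_real (w x))"
  have h_meas [measurable]: "h z \<in> borel_measurable borel" for z
    unfolding h_def by measurable
  have h_norm: "norm (h z x) = x powr (Re z - 1) * w x" if "x > 0" for z x
    using that w_nonneg[of x] by (simp add: h_def norm_mult norm_of_real_powr_complex)
  have h_int: "set_integrable lborel {0<..<1} (h z)" if "Re z > 0" for z
  proof (rule set_integrable_bound[OF int[OF that]])
    show "set_borel_measurable lborel {0<..<1} (h z)"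
      unfolding set_borel_measurable_def by measurable
    show "AE x in lborel. x \<in> {0<..<1} \<longrightarrow> norm (h z x) \<le> norm (x powr (Re z - 1) * w x)"
      by (intro AE_I2) (use h_norm w_nonneg in \<open>auto simp: abs_mult\<close>)
  qed
  thus "set_integrable lborel {0<..<1} (\<lambda>x. of_real x powr (z - 1) * complex_of_real (w x))" if "Re z > 0" for z
    using that by (simp add: h_def)
  \<comment> \<open>Compact intervals exhausting the open unit interval; the summand 2 keeps already
    the first one nonempty.\<close>
  define A :: "nat \<Rightarrow> real set" where "A = (\<lambda>k. cbox (1 / (real k + 2)) (1 - 1 / (real k + 2)))"
  have A_sub: "A k \<subseteq> {0<..<1}" for k
  proof
    fix x assume "x \<in> A k"
    hence x: "1 / (real k + 2) \<le> x" "x \<le> 1 - 1 / (real k + 2)" by (auto simp: A_def)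
    have "0 < 1 / (real k + 2)" by simp
    with x have "0 < x" "x < 1" by linarith+
    thus "x \<in> {0<..<1}" by simp
  qed
  have A_meas [measurable]: "A k \<in> sets lborel" for k by (simp add: A_def)
  have A_inc: "incseq A"
  proof (rule incseq_SucI)
    fix k
    have "1 / (real (Suc k) + 2) \<le> 1 / (real k + 2)" by (simp add: field_simps)
    thus "A k \<subseteq> A (Suc k)" unfolding A_def by (intro subset_box_imp) auto
  qed
  have A_UN: "(\<Union>k. A k) = {0<..<1}"
  proof
    show "{0<..<1} \<subseteq> (\<Union>k. A k)"
    proof
      fix x :: real assume x: "x \<in> {0<..<1}"
      define d where "d = min x (1 - x)"
      have "d > 0" using x by (simp add: d_def)
      then obtain k where "inverse (real (Suc k)) < d" using reals_Archimedean by blast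
      moreover have "1 / (real k + 2) \<le> inverse (real (Suc k))" by (simp add: field_simps)
      ultimately have "1 / (real k + 2) < d" by linarith
      hence "x \<in> A k" by (auto simp: A_def d_def)
      thus "x \<in> (\<Union>k. A k)" by blast
    qed
  qed (use A_sub in blast)
  define J where "J = (\<lambda>k z. LINT x:A k|lborel. h z x)"
  define J0 where "J0 = (\<lambda>z. LINT x:{0<..<1}|lborel. h z x)"
  have J_hol: "J k holomorphic_on {z. Re z > 0}" for k
  proof -
    let ?U = "{z. Re z > 0}"
    have exp_form: "h z x = exp ((z - 1) * of_real (ln x)) * of_real (w x)" if "x \<in> A k" for z x
      using that A_sub[of k] by (auto simp: h_def powr_def Ln_of_real subset_iff)
    have A_eq: "A k = cbox (1 / (real k + 2)) (1 - 1 / (real k + 2))" by (simp add: A_def)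
    have w_cont: "continuous_on (A k) w" using cont A_sub by (rule continuous_on_subset)
    have exp_cont: "continuous_on (A k) (\<lambda>t. exp ((z - 1) * of_real (ln t)) * complex_of_real (w t))" for z
      by (intro continuous_intros w_cont) (use A_sub[of k] in auto)
    have "(\<lambda>z. integral (A k) (\<lambda>x. exp ((z - 1) * of_real (ln x)) * of_real (w x))) holomorphic_on ?U"
      unfolding A_def
    proof (rule leibniz_rule_holomorphic[where
          fx = "\<lambda>z x. of_real (ln x) * exp ((z - 1) * of_real (ln x)) * of_real (w x)"])
      show "((\<lambda>z. exp ((z - 1) * of_real (ln t)) * of_real (w t)) has_field_derivative
          of_real (ln t) * exp ((z - 1) * of_real (ln t)) * of_real (w t)) (at z within ?U)" for z t
        by (auto intro!: derivative_eq_intros)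
      show "(\<lambda>t. exp ((z - 1) * of_real (ln t)) * complex_of_real (w t)) integrable_on
          cbox (1 / (real k + 2)) (1 - 1 / (real k + 2))" for z
        using integrable_continuous[OF exp_cont[unfolded A_def]] .
      have "continuous_on (?U \<times> A k) (\<lambda>y. of_real (w (snd y)) :: complex)"
        by (intro continuous_intros continuous_on_compose2[OF w_cont]) auto
      moreover have "0 < snd y" if "y \<in> ?U \<times> A k" for y using that A_sub[of k] by auto
      ultimately show "continuous_on (?U \<times> cbox (1 / (real k + 2)) (1 - 1 / (real k + 2)))
          (\<lambda>(z, t). of_real (ln t) * exp ((z - 1) * of_real (ln t)) * of_real (w t))"
        unfolding A_eq[symmetric] case_prod_beta by (intro continuous_intros) (auto simp: less_imp_neq[symmetric])
      show "convex ?U" by (rule convex_halfspace_Re_gt)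
    qed
    also have "?this \<longleftrightarrow> J k holomorphic_on ?U"
    proof (rule holomorphic_cong[OF refl])
      fix z :: complex assume z: "z \<in> ?U"
      have "integral (A k) (\<lambda>x. exp ((z - 1) * of_real (ln x)) * of_real (w x)) = integral (A k) (h z)"
        by (rule Henstock_Kurzweil_Integration.integral_cong) (simp add: exp_form)
      also have "\<dots> = J k z" unfolding J_def
        using z by (intro set_borel_integral_eq_integral(2)[symmetric] set_integrable_subset[OF h_int A_meas A_sub]) auto
      finally show "integral (A k) (\<lambda>x. exp ((z - 1) * of_real (ln x)) * of_real (w x)) = J k z" .
    qed
    finally show ?thesis .
  qed
  have "J0 holomorphic_on {z. Re z > 0}"
  proof (rule holomorphic_uniform_sequence[of _ J])
    show "open {z. Re z > 0}" by (rule open_halfspace_Re_gt)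
    show "J k holomorphic_on {z. Re z > 0}" for k by (rule J_hol)
    fix z0 assume "z0 \<in> {z. Re z > 0}"
    \<comment> \<open>With this radius every point of the ball has real part at least
      \<open>a\<close>, and for \<open>x < 1\<close> the smallest exponent gives the largest power,
      so \<open>K\<close> dominates.\<close>
    define a where "a = Re z0 / 2"
    have a: "a > 0" using \<open>z0 \<in> _\<close> by (simp add: a_def)
    have Re_ge: "Re z \<ge> a" if "z \<in> cball z0 a" for z
    proof -
      have "Re z0 - Re z \<le> norm (z0 - z)" using complex_Re_le_cmod[of "z0 - z"] by simp
      also have "\<dots> \<le> a" using that by (simp add: dist_norm)
      finally show ?thesis by (simp add: a_def)
    qed
    define K where "K = (\<lambda>x. x powr (a - 1) * w x)"
    have K_int: "set_integrable lborel {0<..<1} K" unfolding K_def by (rule int[OF a])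
    have tail: "norm (J k z - J0 z) \<le> (LINT x:{0<..<1}|lborel. K x) - (LINT x:A k|lborel. K x)"
      if z: "z \<in> cball z0 a" for k z
    proof -
      have Rz: "Re z > 0" using Re_ge[OF z] a by simp
      let ?B = "{0<..<1} - A k"
      have B: "?B \<in> sets lborel" "?B \<subseteq> {0<..<1}" "A k \<inter> ?B = {}" "A k \<union> ?B = {0<..<1}"
        using A_sub[of k] A_meas[of k] by auto
      have hA: "set_integrable lborel (A k) (h z)" and hB: "set_integrable lborel ?B (h z)"
        using set_integrable_subset[OF h_int[OF Rz] A_meas A_sub] set_integrable_subset[OF h_int[OF Rz] B(1,2)]
        by blast+
      have KA: "set_integrable lborel (A k) K" and KB: "set_integrable lborel ?B K"
        using set_integrable_subset[OF K_int A_meas A_sub] set_integrable_subset[OF K_int B(1,2)]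
        by blast+
      have "J0 z = J k z + (LINT x:?B|lborel. h z x)"
        unfolding J0_def J_def using set_integral_Un[OF B(3) hA hB] B(4) by simp
      hence "norm (J k z - J0 z) = norm (LINT x:?B|lborel. h z x)" by simp
      also have "\<dots> \<le> (LINT x:?B|lborel. norm (h z x))"
        by (rule set_integral_norm_bound[OF hB])
      also have "\<dots> \<le> (LINT x:?B|lborel. K x)"
      proof (rule set_integral_mono[OF set_integrable_norm[OF hB] KB])
        fix x assume "x \<in> ?B"
        hence x: "0 < x" "x < 1" by auto
        have "x powr (Re z - 1) \<le> x powr (a - 1)"
          using x Re_ge[OF z] by (intro powr_mono') auto
        thus "norm (h z x) \<le> K x"
          unfolding h_norm[OF x(1)] K_def using w_nonneg by (intro mult_right_mono)
      qed
      also have "\<dots> = (LINT x:{0<..<1}|lborel. K x) - (LINT x:A k|lborel. K x)"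
        using set_integral_Un[OF B(3) KA KB] B(4) by simp
      finally show ?thesis .
    qed
    have K_lim: "(\<lambda>k. LINT x:A k|lborel. K x) \<longlonglongrightarrow> (LINT x:{0<..<1}|lborel. K x)"
      using set_integral_cont_up[of A lborel K, OF A_meas A_inc, unfolded A_UN, OF K_int] .
    have "uniform_limit (cball z0 a) J J0 sequentially"
    proof (rule uniform_limitI)
      fix e :: real assume "e > 0"
      from order_tendstoD(1)[OF K_lim, of "(LINT x:{0<..<1}|lborel. K x) - e"] \<open>e > 0\<close>
      have "\<forall>\<^sub>F k in sequentially. (LINT x:{0<..<1}|lborel. K x) - e < (LINT x:A k|lborel. K x)" by simp
      thus "\<forall>\<^sub>F k in sequentially. \<forall>z\<in>cball z0 a. dist (J k z) (J0 z) < e"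
      proof eventually_elim
        case (elim k)
        show ?case
        proof
          fix z assume "z \<in> cball z0 a"
          from tail[OF this, of k] elim show "dist (J k z) (J0 z) < e" by (simp add: dist_norm)
        qed
      qed
    qed
    moreover have "cball z0 a \<subseteq> {z. Re z > 0}" using Re_ge a by (force simp: less_le_trans)
    ultimately show "\<exists>d>0. cball z0 d \<subseteq> {z. Re z > 0} \<and> uniform_limit (cball z0 d) J J0 sequentially"
      using a by blast
  qed
  thus "(\<lambda>z. LINT x:{0<..<1}|lborel. of_real x powr (z - 1) * complex_of_real (w x)) holomorphic_on {z. Re z > 0}"
    by (simp add: J0_def h_def)
qed

text \<open>The Beta integral under the substitution of \<open>x\<close> squared for its
  variable.\<close>

lemma mellin_one_minus_square_real:
  fixes a c :: real
  assumes a: "a > 0" and c: "c > 0"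
  shows "set_integrable lborel {0<..<1} (\<lambda>x. x powr (a - 1) * (1 - x\<^sup>2) powr (c - 1))"
    and "(LINT x:{0<..<1}|lborel. x powr (a - 1) * (1 - x\<^sup>2) powr (c - 1)) = Beta (a / 2) c / 2"
proof -
  define f where "f = (\<lambda>t::real. t powr (a / 2 - 1) * (1 - t) powr (c - 1))"
  define K where "K = (\<lambda>x::real. x powr (a - 1) * (1 - x\<^sup>2) powr (c - 1))"
  have img: "(\<lambda>x::real. x\<^sup>2) ` {0<..<1} = {0<..<1}"
  proof
    show "(\<lambda>x::real. x\<^sup>2) ` {0<..<1} \<subseteq> {0<..<1}" by (auto simp: power_less_one_iff)
    show "{0<..<1} \<subseteq> (\<lambda>x::real. x\<^sup>2) ` {0<..<1}"
    proof
      fix y :: real assume "y \<in> {0<..<1}"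
      thus "y \<in> (\<lambda>x::real. x\<^sup>2) ` {0<..<1}" by (intro image_eqI[of _ _ "sqrt y"]) auto
    qed
  qed
  have f: "(f has_integral Beta (a / 2) c) {0<..<1}"
    using has_integral_Beta_real[of "a / 2" c] a c by (simp add: f_def has_integral_Icc_iff_Ioo)
  have "f absolutely_integrable_on {0<..<1}"
    using f by (intro nonnegative_absolutely_integrable_1) (auto simp: f_def)
  hence "f absolutely_integrable_on (\<lambda>x. x\<^sup>2) ` {0<..<1} \<and>
      integral ((\<lambda>x. x\<^sup>2) ` {0<..<1}) f = Beta (a / 2) c"
    unfolding img using f by (simp add: integral_unique)
  hence "(\<lambda>x. \<bar>2 * x\<bar> * f (x\<^sup>2)) absolutely_integrable_on {0<..<1} \<and>
      integral {0<..<1} (\<lambda>x. \<bar>2 * x\<bar> * f (x\<^sup>2)) = Beta (a / 2) c"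
    by (subst has_absolute_integral_change_of_variables_1')
       (auto intro!: derivative_eq_intros simp: inj_on_def power2_eq_iff)
  \<comment> \<open>The Jacobian \<open>2 * x\<close> lifts \<open>x powr (a - 2)\<close> to the
    exponent \<open>a - 1\<close>; its factor 2 is the source of the halved Beta value.\<close>
  moreover have eq: "\<bar>2 * x\<bar> * f (x\<^sup>2) = 2 * K x" if "x \<in> {0<..<1}" for x
  proof -
    have "x\<^sup>2 powr (a / 2 - 1) = x powr (a - 2)"
      using that by (simp add: powr_powr flip: powr_numeral)
    moreover have "x * x powr (a - 2) = x powr (a - 1)"
      using that by (simp add: powr_mult_base)
    ultimately show ?thesis using that by (simp add: f_def K_def)
  qed
  moreover have "(\<lambda>x. \<bar>2 * x\<bar> * f (x\<^sup>2)) absolutely_integrable_on {0<..<1}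
      \<longleftrightarrow> (\<lambda>x. 2 * K x) absolutely_integrable_on {0<..<1}"
    by (rule set_integrable_cong[OF refl refl eq])
  moreover have "integral {0<..<1} (\<lambda>x. \<bar>2 * x\<bar> * f (x\<^sup>2)) = integral {0<..<1} (\<lambda>x. 2 * K x)"
    by (rule Henstock_Kurzweil_Integration.integral_cong[OF eq])
  ultimately have *: "(\<lambda>x. 2 * K x) absolutely_integrable_on {0<..<1}"
    "integral {0<..<1} (\<lambda>x. 2 * K x) = Beta (a / 2) c"
    by metis+
  have "K absolutely_integrable_on {0<..<1}" using *(1) by simp
  \<comment> \<open>Borel measurability brings integrability back from the completed measure to
    \<open>lborel\<close>.\<close>
  moreover have "(\<lambda>x. indicator {0<..<1} x *\<^sub>R K x) \<in> borel_measurable lborel"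
    unfolding K_def by measurable
  ultimately have "set_integrable lborel {0<..<1} K"
    unfolding set_integrable_def by (simp add: integrable_completion)
  moreover from this have "(LINT x:{0<..<1}|lborel. K x) = integral {0<..<1} K"
    by (rule set_borel_integral_eq_integral)
  moreover have "integral {0<..<1} K = Beta (a / 2) c / 2" using *(2) by simp
  ultimately show "set_integrable lborel {0<..<1} (\<lambda>x. x powr (a - 1) * (1 - x\<^sup>2) powr (c - 1))"
    "(LINT x:{0<..<1}|lborel. x powr (a - 1) * (1 - x\<^sup>2) powr (c - 1)) = Beta (a / 2) c / 2"
    by (simp_all add: K_def)
qed

text \<open>Both sides are holomorphic in the right half-plane and agree on the positive reals,
  which accumulate at 1.\<close>

lemma mellin_one_minus_square:
  fixes z :: complex and c :: real
  assumes z: "Re z > 0" and c: "c > 0"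
  defines "f \<equiv> \<lambda>z x. of_real x powr (z - 1) * complex_of_real ((1 - x\<^sup>2) powr (c - 1))"
  shows "set_integrable lborel {0<..<1} (f z)"
    and "(LINT x:{0<..<1}|lborel. f z x) = Beta (z / 2) (of_real c) / 2"
proof -
  define w where "w = (\<lambda>x::real. (1 - x\<^sup>2) powr (c - 1))"
  have w: "w \<in> borel_measurable borel" "\<And>x. w x \<ge> 0" by (auto simp: w_def)
  have "continuous_on {0<..<1} w" unfolding w_def
    by (intro continuous_intros) (auto simp: power2_eq_1_iff)
  note * = holomorphic_mellin_unit_interval[OF w this, unfolded w_def, OF mellin_one_minus_square_real(1)[OF _ c]]
  show "set_integrable lborel {0<..<1} (f z)" using *(1)[OF _ z] by (simp add: f_def)
  let ?J = "\<lambda>z. LINT x:{0<..<1}|lborel. f z x"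
  let ?S = "{z. Re z > 0}"
  have J: "?J holomorphic_on ?S" unfolding f_def using *(2) by simp
  have np: "w \<notin> \<int>\<^sub>\<le>\<^sub>0" if "Re w > 0" for w :: complex
    using that by (auto elim!: nonpos_Ints_cases')
  have B: "(\<lambda>z. Beta (z / 2) (of_real c) / 2) holomorphic_on ?S"
    by (intro holomorphic_intros) (use c in \<open>auto intro!: np\<close>)
  have on_reals: "?J (of_real a) = Beta (of_real a / 2) (of_real c) / 2" if a: "a > 0" for a :: real
  proof -
    have powr_eq: "of_real x powr (of_real a - 1) = complex_of_real (x powr (a - 1))" if "x > 0" for x
      using powr_of_real[of x "a - 1"] that by simp
    have "?J (of_real a) = (LINT x:{0<..<1}|lborel. complex_of_real (x powr (a - 1) * (1 - x\<^sup>2) powr (c - 1)))"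
      by (rule set_lebesgue_integral_cong) (auto simp: f_def powr_eq)
    also have "\<dots> = complex_of_real (LINT x:{0<..<1}|lborel. x powr (a - 1) * (1 - x\<^sup>2) powr (c - 1))"
      by (rule set_integral_complex_of_real)
    also have "\<dots> = Beta (of_real a / 2) (of_real c) / 2"
      unfolding mellin_one_minus_square_real(2)[OF a c] using Beta_complex_of_real[of "a / 2" c] by simp
    finally show ?thesis .
  qed
  have "?J z - Beta (z / 2) (of_real c) / 2 = 0"
  proof (rule analytic_continuation[where f = "\<lambda>z. ?J z - Beta (z / 2) (of_real c) / 2"
        and S = ?S and U = "of_real ` {0<..}" and \<xi> = 1 and w = z])
    show "(\<lambda>z. ?J z - Beta (z / 2) (of_real c) / 2) holomorphic_on ?S" by (intro holomorphic_on_diff J B)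
    show "open ?S" by (rule open_halfspace_Re_gt)
    show "connected ?S" by (intro convex_connected convex_halfspace_Re_gt)
    show "(1::complex) islimpt of_real ` {0<..}"
    proof -
      have "(1::real) islimpt {0<..}" by (intro interior_limit_point) (simp add: interior_open)
      hence "complex_of_real 1 islimpt of_real ` {0<..}" by (intro islimpt_isCont_image) (auto simp: eventually_at_filter)
      thus ?thesis by simp
    qed
  qed (use on_reals z in auto)
  thus "?J z = Beta (z / 2) (of_real c) / 2" by simp
qed

section \<open>Gegenbauer polynomials, their Mellin transforms and the polynomial factor\<close>

lemma gegenbauer_reindexed:
  "gegenbauer lam n x = (\<Sum>r\<le>n div 2. (-1) ^ (n div 2 - r) * pochhammer lam (n div 2 + r + eps n)
     / (fact (2 * r + eps n) * fact (n div 2 - r)) * (2 * x) ^ (2 * r + eps n))"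
proof -
  define m \<epsilon> where "m = n div 2" and "\<epsilon> = eps n"
  have n: "n = 2 * m + \<epsilon>" using eps_div by (simp add: \<epsilon>_def m_def)
  let ?g = "\<lambda>r. (-1)^r * real ((n - r) choose r)
        * ((real n - real r - 1 + lam) gchoose (n - r)) * (2 * x)^(n - 2 * r)"
  \<comment> \<open>Reversing the summation lists ascending powers of \<open>x\<close>, with the
    same index as in \<open>p_eq_sum\<close>.\<close>
  have "gegenbauer lam n x = (\<Sum>r=0..m. ?g (m + 0 - r))"
    unfolding gegenbauer_def m_def[symmetric] by (rule sum.atLeastAtMost_rev)
  also have "\<dots> = (\<Sum>r=0..m. (-1) ^ (m - r) * pochhammer lam (m + r + \<epsilon>)
     / (fact (2 * r + \<epsilon>) * fact (m - r)) * (2 * x) ^ (2 * r + \<epsilon>))"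
  proof (intro sum.cong refl)
    fix r assume "r \<in> {0..m}"
    hence r: "r \<le> m" by simp
    have 1: "n - (m - r) = m + r + \<epsilon>" "n - 2 * (m - r) = 2 * r + \<epsilon>" "m + 0 - r = m - r"
      using r by (auto simp: n)
    have "real n - real (m - r) - 1 + lam = real (m + r + \<epsilon>) + (lam - 1)"
      using r by (simp add: n of_nat_diff)
    hence 2: "(real n - real (m - r) - 1 + lam) gchoose (m + r + \<epsilon>)
        = pochhammer lam (m + r + \<epsilon>) / fact (m + r + \<epsilon>)"
      by (simp only: gchoose_add_of_nat) simp
    have 3: "real ((m + r + \<epsilon>) choose (m - r)) = fact (m + r + \<epsilon>) / (fact (m - r) * fact (2 * r + \<epsilon>))"
    proof -
      have "m + r + \<epsilon> - (m - r) = 2 * r + \<epsilon>" using r by auto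
      thus ?thesis by (subst binomial_fact) auto
    qed
    show "?g (m + 0 - r) = (-1) ^ (m - r) * pochhammer lam (m + r + \<epsilon>)
     / (fact (2 * r + \<epsilon>) * fact (m - r)) * (2 * x) ^ (2 * r + \<epsilon>)"
      unfolding 1 2 3 by simp
  qed
  finally show ?thesis by (simp add: m_def \<epsilon>_def atLeast0AtMost)
qed

text \<open>Integrating monomial by monomial gives Beta values whose second argument is
  \<open>c = lam / 2 + 1 / 4\<close>, positive by the bound on \<open>lam\<close>. Their common
  Gamma quotient is the prescribed one, and the remaining sum is \<open>p\<close>.\<close>

lemma mellinM_eq:
  assumes lam: "lam > - 1 / 2" and s: "Re s > 0"
  shows "mellinM lam n s = Gamma (of_real lam / 2 + 1 / 4) * Gamma ((s + of_nat (eps n)) / 2)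
          / (2 * fact n * Gamma ((s + of_nat n + of_real lam) / 2 + 1 / 4)) * (2 * p lam n s)"
proof -
  define m \<epsilon> where "m = n div 2" and "\<epsilon> = eps n"
  have n: "n = 2 * m + \<epsilon>" using eps_div by (simp add: \<epsilon>_def m_def)
  define c where "c = lam / 2 + 1 / 4"
  have c: "c > 0" using lam by (simp add: c_def)
  define f where "f = (\<lambda>z x. of_real x powr (z - 1) * complex_of_real ((1 - x\<^sup>2) powr (c - 1)))"
  define a where "a = (\<lambda>r. (-1) ^ (m - r) * pochhammer lam (m + r + \<epsilon>)
     / (fact (2 * r + \<epsilon>) * fact (m - r)) * 2 ^ (2 * r + \<epsilon>))"
  have geg: "gegenbauer lam n x = (\<Sum>r\<le>m. a r * x ^ (2 * r + \<epsilon>))" for x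
    unfolding gegenbauer_reindexed m_def[symmetric] \<epsilon>_def[symmetric] a_def
    by (simp add: power_mult_distrib mult_ac)
  have mono: "of_real (x ^ k) * complex_of_real x powr (s - 1) = of_real x powr (s + of_nat k - 1)"
    if "x > 0" for x :: real and k
  proof -
    have "s + of_nat k - 1 = of_nat k + (s - 1)" by simp
    hence "complex_of_real x powr (s + of_nat k - 1) = of_real x powr of_nat k * of_real x powr (s - 1)"
      by (simp only: powr_add)
    thus ?thesis using that by (simp add: powr_complexpow)
  qed
  have Re: "Re (s + of_nat (2 * r + \<epsilon>)) > 0" for r using s by simp
  have "mellinM lam n s = (LINT x:{0<..<1}|lborel. \<Sum>r\<le>m. of_real (a r) * f (s + of_nat (2 * r + \<epsilon>)) x)"
    unfolding mellinM_def set_lebesgue_integral_def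
  proof (intro Bochner_Integration.integral_cong refl)
    fix x :: real
    have w: "lam / 2 - 3 / 4 = c - 1" by (simp add: c_def)
    \<comment> \<open>At both endpoints the closed-interval integrand is 0 because
      \<open>0 powr a = 0\<close>, so the interval may be taken open.\<close>
    consider "x \<notin> {0..1}" | "x = 0" | "x = 1" | "x \<in> {0<..<1}" by fastforce
    thus "indicator {0..1} x *\<^sub>R (of_real (gegenbauer lam n x) * of_real x powr (s - 1)
         * of_real ((1 - x\<^sup>2) powr (lam / 2 - 3 / 4)))
      = indicator {0<..<1} x *\<^sub>R (\<Sum>r\<le>m. of_real (a r) * f (s + of_nat (2 * r + \<epsilon>)) x)"
    proof cases
      case 4
      have "of_real (gegenbauer lam n x) * of_real x powr (s - 1) * of_real ((1 - x\<^sup>2) powr (c - 1))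
         = (\<Sum>r\<le>m. of_real (a r) * (of_real (x ^ (2 * r + \<epsilon>)) * complex_of_real x powr (s - 1))
              * of_real ((1 - x\<^sup>2) powr (c - 1)))"
        unfolding geg of_real_sum of_real_mult sum_distrib_right by (simp only: mult_ac)
      also have "\<dots> = (\<Sum>r\<le>m. of_real (a r) * f (s + of_nat (2 * r + \<epsilon>)) x)"
        using 4 by (simp only: mono greaterThanLessThan_iff f_def mult.assoc)
      finally show ?thesis using 4 by (simp add: w)
    qed auto
  qed
  also have "\<dots> = (\<Sum>r\<le>m. LINT x:{0<..<1}|lborel. of_real (a r) * f (s + of_nat (2 * r + \<epsilon>)) x)"
    unfolding set_lebesgue_integral_def scaleR_sum_right
  proof (rule Bochner_Integration.integral_sum)
    fix r
    have "set_integrable lborel {0<..<1} (\<lambda>x. of_real (a r) * f (s + of_nat (2 * r + \<epsilon>)) x)"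
      unfolding f_def using mellin_one_minus_square(1)[OF Re c] by (intro set_integrable_mult_right) auto
    thus "integrable lborel (\<lambda>x. indicator {0<..<1} x *\<^sub>R (of_real (a r) * f (s + of_nat (2 * r + \<epsilon>)) x))"
      by (simp add: set_integrable_def)
  qed
  also have "\<dots> = (\<Sum>r\<le>m. of_real (a r) * (Beta ((s + of_nat (2 * r + \<epsilon>)) / 2) (of_real c) / 2))"
    unfolding f_def set_integral_mult_right mellin_one_minus_square(2)[OF Re c] ..
  finally have M: "mellinM lam n s = \<dots>" .
  define z e where "z = (s + of_nat \<epsilon>) / 2" and "e = (s + of_real lam + of_nat \<epsilon>) / 2 + 1 / 4"
  have Re_z: "Re z > 0" using s by (simp add: z_def)
  have ez: "z + of_real c = e" by (simp add: z_def e_def c_def field_simps)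
  have Re_e: "Re e > 0" unfolding ez[symmetric] using Re_z c by simp
  have np: "w \<notin> \<int>\<^sub>\<le>\<^sub>0" if "Re w > 0" for w :: complex
    using that by (auto elim!: nonpos_Ints_cases')
  \<comment> \<open>Rising factorials pull \<open>r\<close> out of the Gamma factors: the numerator
    is reduced to \<open>Gamma z\<close>, the denominator is extended to
    \<open>Gamma (e + of_nat m)\<close>, and the quotient left over is the same for all
    \<open>r\<close>.\<close>
  have Beta: "Beta ((s + of_nat (2 * r + \<epsilon>)) / 2) (of_real c)
      = Gamma (of_real c) * Gamma z / Gamma (e + of_nat m) * (pochhammer z r * pochhammer (e + of_nat r) (m - r))"
    if r: "r \<le> m" for r
  proof -
    have *: "(s + of_nat (2 * r + \<epsilon>)) / 2 = z + of_nat r" by (simp add: z_def field_simps)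
    have **: "z + of_nat r + of_real c = e + of_nat r" unfolding ez[symmetric] by simp
    have "Gamma (z + of_nat r) = pochhammer z r * Gamma z"
      using pochhammer_Gamma[of z r] np[OF Re_z] by (simp add: Gamma_eq_zero_iff)
    moreover have "pochhammer (e + of_nat r) (m - r) = Gamma (e + of_nat m) / Gamma (e + of_nat r)"
      using pochhammer_Gamma[of "e + of_nat r" "m - r"] np[of "e + of_nat r"] Re_e r
      by (simp add: of_nat_diff)
    moreover have "Gamma (e + of_nat m) \<noteq> 0"
      using np[of "e + of_nat m"] Re_e by (simp add: Gamma_eq_zero_iff)
    ultimately show ?thesis unfolding * Beta_def ** by simp
  qed
  have "mellinM lam n s = (\<Sum>r\<le>m. Gamma (of_real c) * Gamma z / (2 * Gamma (e + of_nat m))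
      * (of_real (a r) * pochhammer z r * pochhammer (e + of_nat r) (m - r)))"
    unfolding M
  proof (intro sum.cong refl)
    fix r assume "r \<in> {..m}"
    hence r: "r \<le> m" by simp
    show "of_real (a r) * (Beta ((s + of_nat (2 * r + \<epsilon>)) / 2) (of_real c) / 2)
        = Gamma (of_real c) * Gamma z / (2 * Gamma (e + of_nat m))
          * (of_real (a r) * pochhammer z r * pochhammer (e + of_nat r) (m - r))"
      unfolding Beta[OF r] by (simp add: mult_ac)
  qed
  also have "\<dots> = Gamma (of_real c) * Gamma z / (2 * Gamma (e + of_nat m))
      * (\<Sum>r\<le>m. of_real (a r) * pochhammer z r * pochhammer (e + of_nat r) (m - r))"
    by (simp only: sum_distrib_left)
  also have "(\<Sum>r\<le>m. of_real (a r) * pochhammer z r * pochhammer (e + of_nat r) (m - r))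
      = 2 * p lam n s / fact n"
    unfolding p_eq_sum m_def[symmetric] \<epsilon>_def[symmetric] e_def[symmetric] z_def[symmetric] a_def
    by (simp add: pochhammer_of_real[symmetric] mult_ac)
  also have "of_real c = of_real lam / 2 + (1 / 4 :: complex)" by (simp add: c_def)
  also have "e + of_nat m = (s + of_nat n + of_real lam) / 2 + 1 / 4" by (simp add: e_def n field_simps)
  finally show ?thesis by (simp add: z_def \<epsilon>_def)
qed

text \<open>The Gamma factor has no zero for \<open>Re s > 0\<close>, so it can be cancelled, and
  agreement on the positive reals determines the polynomial. Comparison with
  \<open>mellinM_eq\<close> gives twice \<open>p\<close>, hence the constant 1/2.\<close>

lemma mellin_poly_eq:
  assumes lam: "lam > - 1 / 2"
  shows "\<exists>!P. is_mellin_poly lam n P" and "p lam n s = 1 / 2 * poly (mellin_poly lam n) s"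
proof -
  obtain P0 where P0: "\<And>s. poly P0 s = p lam n s" using ex_poly_p by blast
  have np: "w \<notin> \<int>\<^sub>\<le>\<^sub>0" if "Re w > 0" for w :: complex
    using that by (auto elim!: nonpos_Ints_cases')
  have "is_mellin_poly lam n P \<longleftrightarrow> P = smult 2 P0" for P
  proof
    assume "P = smult 2 P0"
    thus "is_mellin_poly lam n P" unfolding is_mellin_poly_def using mellinM_eq[OF lam] P0 by simp
  next
    assume P: "is_mellin_poly lam n P"
    have "poly (P - smult 2 P0) s = 0" if s: "Re s > 0" for s
    proof -
      let ?C = "Gamma (of_real lam / 2 + 1 / 4) * Gamma ((s + of_nat (eps n)) / 2)
          / (2 * fact n * Gamma ((s + of_nat n + of_real lam) / 2 + 1 / 4))"
      have "Re (of_real lam / 2 + 1 / 4) > 0" using lam by simp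
      moreover have "Re ((s + of_nat (eps n)) / 2) > 0" using s by simp
      moreover have "Re ((s + of_nat n + of_real lam) / 2 + 1 / 4) > 0"
      proof -
        have "Re s + real n + lam + 1 / 2 > 0" using s lam by simp
        thus ?thesis by (simp add: field_simps)
      qed
      ultimately have "?C \<noteq> 0" using np by (simp add: Gamma_eq_zero_iff del: Re_divide_numeral plus_complex.sel)
      moreover have "?C * poly P s = ?C * (2 * p lam n s)"
        using P s mellinM_eq[OF lam s, of n] unfolding is_mellin_poly_def by metis
      ultimately have "poly P s = 2 * p lam n s" using mult_left_cancel by blast
      thus ?thesis by (simp add: P0)
    qed
    hence "of_real ` {0<..} \<subseteq> {s. poly (P - smult 2 P0) s = 0}" by auto
    moreover have "infinite (complex_of_real ` {0<..})"
      by (subst finite_image_iff) (auto simp: inj_on_def infinite_Ioi)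
    ultimately have "P - smult 2 P0 = 0" using poly_roots_finite finite_subset by blast
    thus "P = smult 2 P0" by simp
  qed
  hence *: "is_mellin_poly lam n = (\<lambda>P. P = smult 2 P0)" by (intro ext)
  show "\<exists>!P. is_mellin_poly lam n P" unfolding * by simp
  show "p lam n s = 1 / 2 * poly (mellin_poly lam n) s"
    unfolding mellin_poly_def * by (simp add: P0)
qed

subsection \<open>Properties of the rational functions\<close>

text \<open>At \<open>lam = 1\<close>, the case of Chebyshev polynomials of the second kind, the
  binomials in \<open>lam\<close> become ordinary ones: the outer one is 1 and the inner ones cancel
  the divisors \<open>(n + r) choose r\<close>.\<close>

lemma p_even_Chebyshev:
  assumes "no_pole 1 (2 * n) s"
  shows "p 1 (2 * n) s = fact n * fact (2 * n) * (of_nat n + s / 2 - 1 / 4 gchoose n)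
            * (\<Sum>r=0..n. (-1)^(n - r) * 2 powi (2 * int r - 1)
                 * of_nat ((n + r) choose (2 * r)) * ((s - 2) / 2 + of_nat r gchoose r)
                 / (s / 2 - 1 / 4 + of_nat r gchoose r))"
proof -
  have 1: "of_nat n + of_real 1 - 1 = (of_nat n :: complex)" by simp
  have 2: "((of_nat n :: complex) gchoose n) = 1" by (simp flip: binomial_gbinomial)
  have 3: "of_nat n + (s + of_real 1) / 2 - 3 / 4 = of_nat n + s / 2 - 1 / 4"
    "(s + of_real 1) / 2 - 3 / 4 = s / 2 - 1 / 4" by (simp_all add: field_simps)
  have 4: "of_nat n + of_nat r + of_real 1 - 1 = (of_nat (n + r) :: complex)" for r by simp
  have 5: "((of_nat (n + r) :: complex) gchoose r) = of_nat ((n + r) choose r)" for r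
    by (simp only: binomial_gbinomial)
  have 6: "of_nat ((n + r) choose r) \<noteq> (0 :: complex)" for r by (simp only: of_nat_eq_0_iff) simp
  show ?thesis
    unfolding p_even_S32[OF assms] S32_even_def 1 2 3 4 5
    using 6 by (simp del: of_nat_add add: mult.assoc)
qed

lemma p_odd_Chebyshev:
  assumes "no_pole 1 (2 * n + 1) s"
  shows "p 1 (2 * n + 1) s = fact n * fact (2 * n + 1) * (of_nat n + s / 2 + 1 / 4 gchoose n)
            * (\<Sum>r=0..n. (-1)^(n - r) * 2 ^ (2 * r)
                 * of_nat ((n + r + 1) choose (2 * r + 1)) * ((s - 1) / 2 + of_nat r gchoose r)
                 / (s / 2 + 1 / 4 + of_nat r gchoose r))"
proof -
  have 1: "of_nat n + of_real 1 = (of_nat (n + 1) :: complex)" by simp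
  have 2: "((of_nat (n + 1) :: complex) gchoose (n + 1)) = 1" by (simp only: binomial_n_n of_nat_1 flip: binomial_gbinomial)
  have 3: "of_nat n + (s + of_real 1) / 2 - 1 / 4 = of_nat n + s / 2 + 1 / 4"
    "(s + of_real 1) / 2 - 1 / 4 = s / 2 + 1 / 4" by (simp_all add: field_simps)
  have 4: "of_nat n + of_nat r + of_real 1 = (of_nat (n + r + 1) :: complex)" for r by simp
  have 5: "((of_nat (n + r + 1) :: complex) gchoose r) = of_nat ((n + r + 1) choose r)" for r
    by (simp only: binomial_gbinomial)
  have 6: "of_nat ((n + r + 1) choose r) \<noteq> (0 :: complex)" for r by (simp only: of_nat_eq_0_iff) simp
  show ?thesis
    unfolding p_odd_S32[OF assms] S32_odd_def 4 1 2 3 5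
    using 6 by (simp del: of_nat_add fact_Suc of_nat_Suc binomial_Suc_Suc add: mult.assoc)
qed

lemma p_nonzero_right_of_1:
  assumes lam: "lam > - 1 / 2" "lam \<noteq> 0" and x: "x > 1 / 2"
  shows "p lam n (of_real x) \<noteq> 0"
proof -
  have np: "no_pole lam n (of_real x)" using x by (intro no_pole_right_half_plane lam) simp
  have "normalized_mellin lam n x > 0" by (rule normalized_mellin_bounds[OF lam(1) x])
  thus ?thesis
    unfolding p_eq_normalized[OF lam(1) np] normalized_mellin_of_real[OF lam(1)]
    using pochhammer_2_lam_nonzero[OF lam] np by (simp add: no_pole_iff)
qed

lemma p_nonzero_at_pole:
  assumes lam: "lam > - 1 / 2" "lam \<noteq> 0" and pole: "\<not> no_pole lam n s"
  shows "p lam n s \<noteq> 0"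
proof -
  obtain k where k: "(s + of_real lam + of_nat (eps n)) / 2 + 1 / 4 = - of_nat k"
    using pole by (auto simp: no_pole_iff pochhammer_eq_0_iff)
  \<comment> \<open>Substituting the pole equation shows that \<open>1 - s\<close> is real and
    exceeds 1/2, where \<open>p\<close> is nonzero; reflection then carries this back to
    \<open>s\<close>.\<close>
  have "1 - s = 3 / 2 + of_real lam + of_nat (eps n) - 2 * ((s + of_real lam + of_nat (eps n)) / 2 + 1 / 4)"
    by (simp add: field_simps)
  hence "1 - s = of_real (3 / 2 + lam + real (eps n) + 2 * real k)" unfolding k by simp
  moreover have "3 / 2 + lam + real (eps n) + 2 * real k > 1 / 2" using lam by simp
  ultimately have "p lam n (1 - s) \<noteq> 0" using p_nonzero_right_of_1[OF lam] by metis
  thus ?thesis using p_reflection[OF lam(1), of n s] by simp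
qed

lemma tendsto_q_1:
  assumes lam: "lam > - 1 / 2" "lam \<noteq> 0" and n: "n \<ge> 1"
  shows "((\<lambda>x::real. q lam n (of_real x)) \<longlongrightarrow> 1) at_top"
proof -
  have "((\<lambda>x::real. complex_of_real (normalized_mellin lam n x)) \<longlongrightarrow> of_real 1) at_top"
    by (intro tendsto_of_real normalized_mellin_tendsto_1 lam)
  moreover have "\<forall>\<^sub>F x in at_top. complex_of_real (normalized_mellin lam n x) = q lam n (of_real x)"
    using eventually_gt_at_top[of 0]
  proof eventually_elim
    case (elim x)
    hence "no_pole lam n (of_real x)" by (intro no_pole_right_half_plane lam) simp
    from q_eq_normalized[OF lam n this] show ?case
      by (simp add: normalized_mellin_of_real[OF lam(1)])
  qed
  ultimately show ?thesis by (simp add: tendsto_cong)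
qed

text \<open>A common divisor of positive degree would have a complex root, which both polynomials
  would share.\<close>

lemma coprime_if_no_common_root:
  fixes N D :: "complex poly"
  assumes "D \<noteq> 0" and "\<And>z. poly D z = 0 \<Longrightarrow> poly N z \<noteq> 0"
  shows "coprime N D"
proof (rule coprimeI)
  fix c assume c: "c dvd N" "c dvd D"
  have "degree c = 0"
  proof (rule ccontr)
    assume "degree c \<noteq> 0"
    hence "\<not> constant (poly c)" by (simp add: constant_degree)
    then obtain z where "poly c z = 0" using Fundamental_Theorem_Algebra.fundamental_theorem_of_algebra by blast
    hence "poly N z = 0" "poly D z = 0" using c by (auto elim!: dvdE)
    thus False using assms by blast
  qed
  moreover have "c \<noteq> 0" using c assms by auto
  ultimately show "is_unit c" by (simp add: is_unit_iff_degree)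
qed

lemma q_coprime_fraction:
  assumes lam: "lam > - 1 / 2" "lam \<noteq> 0" and n: "n \<ge> 1"
  shows "\<exists>N D :: complex poly.
          (\<forall>s. poly N s = 2 ^ (2 * (n div 2) + 1) * p lam n s)
        \<and> (\<forall>s. poly D s = pochhammer (2 * of_real lam) n * q_den lam n s)
        \<and> (\<forall>s. no_pole lam n s \<longrightarrow> poly D s \<noteq> 0 \<and> q lam n s = poly N s / poly D s)
        \<and> coprime N D \<and> degree N = n div 2 \<and> degree D = n div 2"
proof -
  note nz = pochhammer_2_lam_nonzero[OF lam, of n]
  obtain P where P: "degree P \<le> n div 2" "\<And>s. poly P s = p lam n s" using ex_poly_p by blast
  obtain Q where Q: "degree Q = n div 2"
    "\<And>s. poly Q s = pochhammer (s / 2 + ((of_real lam + of_nat (eps n)) / 2 + 1 / 4) :: complex) (n div 2)"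
    using ex_poly_pochhammer by blast
  define N where "N = smult (2 ^ (2 * (n div 2) + 1)) P"
  define D where "D = smult (pochhammer (2 * of_real lam) n * 4 ^ (n div 2)) Q"
  have N: "poly N s = 2 ^ (2 * (n div 2) + 1) * p lam n s" for s by (simp add: N_def P)
  have eq: "(s + of_real lam + of_nat (eps n)) / 2 + 1 / 4
      = s / 2 + ((of_real lam + of_nat (eps n)) / 2 + 1 / 4)" for s :: complex by (simp add: add_divide_distrib)
  have D: "poly D s = pochhammer (2 * of_real lam) n * q_den lam n s" for s
    unfolding q_den_eq D_def poly_smult Q eq by simp
  have deg_D: "degree D = n div 2" using nz by (simp add: D_def Q)
  have D_0: "poly D s = 0 \<longleftrightarrow> \<not> no_pole lam n s" for s
    using nz by (simp add: D q_den_eq_0_iff)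
  have q: "q lam n s = poly N s / poly D s" if "no_pole lam n s" for s
    unfolding N D by (rule q_eq_p[OF lam(1) n that])
  have "no_pole lam n 1" by (intro no_pole_right_half_plane lam) simp
  hence "D \<noteq> 0" using D_0[of 1] by auto
  hence "coprime N D" 
    by (rule coprime_if_no_common_root) (simp add: D_0 N p_nonzero_at_pole[OF lam])
  \<comment> \<open>A numerator of smaller degree would force \<open>q\<close> to tend to 0 along
    the reals, whereas its limit is 1. This rules out cancellation of the leading terms of
    \<open>p\<close>.\<close>
  moreover have "degree N = n div 2"
  proof (rule ccontr)
    assume "degree N \<noteq> n div 2"
    hence "degree N < degree D" using P(1) by (simp add: N_def deg_D)
    hence "((\<lambda>x. poly N x / poly D x) \<longlongrightarrow> 0) at_infinity" by (rule poly_divide_tendsto_0_at_infinity)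
    from filterlim_compose[OF this filterlim_compose[OF filterlim_of_real_at_infinity filterlim_ident]]
    have "((\<lambda>x::real. poly N (of_real x) / poly D (of_real x)) \<longlongrightarrow> 0) at_top" by simp
    moreover have "\<forall>\<^sub>F x in at_top. poly N (of_real x) / poly D (of_real x) = q lam n (of_real x)"
      using eventually_gt_at_top[of 0]
      by eventually_elim (intro q[symmetric] no_pole_right_half_plane lam, simp)
    ultimately have "((\<lambda>x::real. q lam n (of_real x)) \<longlongrightarrow> 0) at_top" by (simp add: tendsto_cong)
    from tendsto_unique[OF _ this tendsto_q_1[OF lam n]] show False by simp
  qed
  ultimately show ?thesis using N D D_0 q deg_D by blast
qed

lemma q_holomorphic:
  assumes lam: "lam > - 1 / 2" "lam \<noteq> 0" and n: "n \<ge> 1"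
  shows "q lam n holomorphic_on {s. Re s > 0}"
proof -
  obtain N D where ND: "\<And>s. no_pole lam n s \<Longrightarrow> poly D s \<noteq> 0 \<and> q lam n s = poly N s / poly D s"
    using q_coprime_fraction[OF lam n] by blast
  have "(\<lambda>s. poly N s / poly D s) holomorphic_on {s. Re s > 0}"
    using ND no_pole_right_half_plane[OF lam(1)] by (intro holomorphic_intros) auto
  also have "?this \<longleftrightarrow> ?thesis"
    using ND no_pole_right_half_plane[OF lam(1)] by (intro holomorphic_cong) auto
  finally show ?thesis .
qed

lemma q_eq_0_iff:
  assumes lam: "lam > - 1 / 2" "lam \<noteq> 0" and n: "n \<ge> 1" and np: "no_pole lam n s"
  shows "q lam n s = 0 \<longleftrightarrow> p lam n s = 0"
  unfolding q_eq_p[OF lam(1) n np] using pochhammer_2_lam_nonzero[OF lam, of n] np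
  by (simp add: q_den_eq_0_iff)

lemma q_real_bounds:
  assumes lam: "lam > - 1 / 2" "lam \<noteq> 0" and n: "n \<ge> 2" and x: "x > 1 / 2"
  shows "q lam n (of_real x) \<in> complex_of_real ` {0<..<1}"
proof -
  have "no_pole lam n (of_real x)" using x by (intro no_pole_right_half_plane lam) simp
  hence "q lam n (of_real x) = of_real (normalized_mellin lam n x)"
    using n by (simp add: q_eq_normalized[OF lam] normalized_mellin_of_real[OF lam(1)])
  thus ?thesis using normalized_mellin_bounds[OF lam(1) x] n by auto
qed

text \<open>The filter \<open>at_left 1\<close> expresses both convergence to 1 and values
  eventually below 1; the latter come from the strict bound, hence \<open>n \<ge> 2\<close>.\<close>

lemma filterlim_q_at_left_1:
  assumes lam: "lam > - 1 / 2" "lam \<noteq> 0" and n: "n \<ge> 2"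
  shows "filterlim (\<lambda>x::real. Re (q lam n (of_real x))) (at_left 1) at_top"
  unfolding filterlim_at
proof
  show "((\<lambda>x::real. Re (q lam n (of_real x))) \<longlongrightarrow> 1) at_top"
    using tendsto_Re[OF tendsto_q_1[OF lam, of n]] n by simp
  show "\<forall>\<^sub>F x in at_top. Re (q lam n (of_real x)) \<in> {..<1} \<and> Re (q lam n (of_real x)) \<noteq> 1"
    using eventually_gt_at_top[of 1]
  proof eventually_elim
    case (elim x)
    hence "q lam n (of_real x) \<in> complex_of_real ` {0<..<1}" by (intro q_real_bounds lam n) simp
    thus ?case by auto
  qed
qed

text \<open>The exceptional index: the series consists of its constant term, so the value 1 is
  attained and the strict bound fails.\<close>

lemma q_1:
  assumes lam: "lam > - 1 / 2" "lam \<noteq> 0"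
  shows "q lam 1 s = 1"
proof -
  have "no_pole lam 1 s" by (simp add: no_pole_iff)
  from q_eq_normalized[OF lam _ this] show ?thesis by (simp add: normalized_mellin_def)
qed

lemma q_reflection:
  assumes lam: "lam > - 1 / 2" "lam \<noteq> 0" and n: "n \<ge> 1"
    and np: "no_pole lam n s" "no_pole lam n (1 - s)"
  shows "q lam n s = (-1) ^ (n div 2)
            * (of_nat (n div 2) + (1 - s + of_real lam + of_nat (eps n)) / 2 - 3 / 4 gchoose (n div 2))
            * inverse (of_nat (n div 2) + (s + of_real lam + of_nat (eps n)) / 2 - 3 / 4 gchoose (n div 2))
            * q lam n (1 - s)"
proof -
  have *: "(of_nat m + z / 2 - 3 / 4 gchoose m) = pochhammer (z / 2 + 1 / 4) m / fact m" for z :: complex and m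
    using gchoose_add_of_nat[of m "z / 2 - 3 / 4"] by (simp add: algebra_simps)
  show ?thesis
    unfolding * q_eq_normalized[OF lam n np(1)] q_eq_normalized[OF lam n np(2)]
    using normalized_mellin_reflection[OF lam(1) np] np(1) by (simp add: no_pole_iff field_simps)
qed

theorem theorem5:
  fixes lam :: real
  assumes "lam > - 1 / 2" and "lam \<noteq> 0"
  shows
    \<comment> \<open>(a)\<close>
    "(\<forall>n. (\<exists>!P. is_mellin_poly lam n P) \<and>
          (\<exists>c. c \<noteq> 0 \<and> (\<forall>s. p lam n s = c * poly (mellin_poly lam n) s)))
    \<and> (\<forall>n s. no_pole lam (2 * n) s \<longrightarrow>
          p lam (2 * n) s =
            fact n * fact (2 * n) * (of_nat n + of_real lam - 1 gchoose n)
            * (of_nat n + (s + of_real lam) / 2 - 3 / 4 gchoose n) * S32_even lam n s)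
    \<and> (\<forall>n s. no_pole lam (2 * n + 1) s \<longrightarrow>
          p lam (2 * n + 1) s =
            fact n * fact (2 * n + 1) * (of_nat n + of_real lam gchoose (n + 1))
            * (of_nat n + (s + of_real lam) / 2 - 1 / 4 gchoose n) * S32_odd lam n s)
    \<and> (\<forall>n s. no_pole 1 (2 * n) s \<longrightarrow>
          p 1 (2 * n) s =
            fact n * fact (2 * n) * (of_nat n + s / 2 - 1 / 4 gchoose n)
            * (\<Sum>r=0..n. (-1)^(n - r) * 2 powi (2 * int r - 1)
                 * of_nat ((n + r) choose (2 * r)) * ((s - 2) / 2 + of_nat r gchoose r)
                 / (s / 2 - 1 / 4 + of_nat r gchoose r)))
    \<and> (\<forall>n s. no_pole 1 (2 * n + 1) s \<longrightarrow>
          p 1 (2 * n + 1) s =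
            fact n * fact (2 * n + 1) * (of_nat n + s / 2 + 1 / 4 gchoose n)
            * (\<Sum>r=0..n. (-1)^(n - r) * 2 ^ (2 * r)
                 * of_nat ((n + r + 1) choose (2 * r + 1)) * ((s - 1) / 2 + of_nat r gchoose r)
                 / (s / 2 + 1 / 4 + of_nat r gchoose r)))
    \<comment> \<open>(b)\<close>
    \<and> (\<forall>n\<ge>1. \<forall>s. no_pole lam (2 * n) s \<longrightarrow>
          q lam (2 * n) s =
            2 * p lam (2 * n) s
            / (of_real lam * fact (n - 1) * fact (2 * n)
               * Gbinom (2 * of_nat n + 2 * of_real lam - 1) (2 * of_nat n - 1)
               * (of_nat n + (s + of_real lam) / 2 - 3 / 4 gchoose n))
        \<and> q lam (2 * n) s =
            2 ^ (2 * n + 1) * p lam (2 * n) s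
            / (pochhammer (2 * of_real lam) (2 * n)
               * (\<Prod>j=1..n. 2 * s + 2 * of_real lam + 4 * of_nat j - 3)))
    \<and> (\<forall>n s. no_pole lam (2 * n + 1) s \<longrightarrow>
          q lam (2 * n + 1) s =
            p lam (2 * n + 1) s
            / (of_real lam * fact n * fact (2 * n)
               * Gbinom (2 * of_nat n + 2 * of_real lam) (2 * of_nat n)
               * (of_nat n + (s + of_real lam) / 2 - 1 / 4 gchoose n))
        \<and> q lam (2 * n + 1) s =
            2 ^ (2 * n + 1) * p lam (2 * n + 1) s
            / (pochhammer (2 * of_real lam) (2 * n + 1)
               * (\<Prod>j=1..n. 2 * s + 2 * of_real lam + 4 * of_nat j - 1)))
    \<and> (\<forall>n\<ge>1. \<exists>N D :: complex poly.
          (\<forall>s. poly N s = 2 ^ (2 * (n div 2) + 1) * p lam n s)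
        \<and> (\<forall>s. poly D s = pochhammer (2 * of_real lam) n * q_den lam n s)
        \<and> (\<forall>s. no_pole lam n s \<longrightarrow> poly D s \<noteq> 0 \<and> q lam n s = poly N s / poly D s)
        \<and> coprime N D \<and> degree N = n div 2 \<and> degree D = n div 2)
    \<comment> \<open>(c)\<close>
    \<and> (\<forall>n\<ge>1.
          (\<forall>s. Re s > 0 \<longrightarrow> no_pole lam n s)
        \<and> q lam n holomorphic_on {s. Re s > 0}
        \<and> (\<forall>s. Re s = 1 / 2 \<longrightarrow> (q lam n s = 0 \<longleftrightarrow> p lam n s = 0))
        \<and> {t::real. p lam n (1 / 2 + \<i> * of_real t) = 0}
            = {t::real. q lam n (1 / 2 + \<i> * of_real t) = 0})
    \<and> (\<forall>n\<ge>2.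
          (\<forall>x::real. x > 1 \<longrightarrow> q lam n (of_real x) \<in> complex_of_real ` {0<..<1})
        \<and> filterlim (\<lambda>x::real. Re (q lam n (of_real x))) (at_left 1) at_top)
    \<and> (\<forall>s. q lam 1 s = 1)
    \<and> (\<forall>n\<ge>1. \<forall>s. no_pole lam n s \<and> no_pole lam n (1 - s) \<longrightarrow>
          q lam n s =
            (-1) ^ (n div 2)
            * (of_nat (n div 2) + (1 - s + of_real lam + of_nat (eps n)) / 2 - 3 / 4
                 gchoose (n div 2))
            * inverse (of_nat (n div 2) + (s + of_real lam + of_nat (eps n)) / 2 - 3 / 4
                 gchoose (n div 2))
            * q lam n (1 - s))"
proof (intro conjI allI impI)
  fix n
  show "\<exists>!P. is_mellin_poly lam n P" by (rule mellin_poly_eq[OF assms(1)])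
  show "\<exists>c. c \<noteq> 0 \<and> (\<forall>s. p lam n s = c * poly (mellin_poly lam n) s)"
    using mellin_poly_eq(2)[OF assms(1)] by (intro exI[of _ "1 / 2"]) simp
next
  fix n s assume "no_pole lam (2 * n) s"
  thus "p lam (2 * n) s =
            fact n * fact (2 * n) * (of_nat n + of_real lam - 1 gchoose n)
            * (of_nat n + (s + of_real lam) / 2 - 3 / 4 gchoose n) * S32_even lam n s"
    by (rule p_even_S32)
next
  fix n s assume "no_pole lam (2 * n + 1) s"
  thus "p lam (2 * n + 1) s =
            fact n * fact (2 * n + 1) * (of_nat n + of_real lam gchoose (n + 1))
            * (of_nat n + (s + of_real lam) / 2 - 1 / 4 gchoose n) * S32_odd lam n s"
    by (rule p_odd_S32)
next
  fix n s assume "no_pole 1 (2 * n) s"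
  thus "p 1 (2 * n) s = fact n * fact (2 * n) * (of_nat n + s / 2 - 1 / 4 gchoose n)
            * (\<Sum>r=0..n. (-1)^(n - r) * 2 powi (2 * int r - 1)
                 * of_nat ((n + r) choose (2 * r)) * ((s - 2) / 2 + of_nat r gchoose r)
                 / (s / 2 - 1 / 4 + of_nat r gchoose r))"
    by (rule p_even_Chebyshev)
next
  fix n s assume "no_pole 1 (2 * n + 1) s"
  thus "p 1 (2 * n + 1) s = fact n * fact (2 * n + 1) * (of_nat n + s / 2 + 1 / 4 gchoose n)
            * (\<Sum>r=0..n. (-1)^(n - r) * 2 ^ (2 * r)
                 * of_nat ((n + r + 1) choose (2 * r + 1)) * ((s - 1) / 2 + of_nat r gchoose r)
                 / (s / 2 + 1 / 4 + of_nat r gchoose r))"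
    by (rule p_odd_Chebyshev)
next
  fix n :: nat and s assume n: "1 \<le> n" and np: "no_pole lam (2 * n) s"
  show "q lam (2 * n) s =
            2 * p lam (2 * n) s
            / (of_real lam * fact (n - 1) * fact (2 * n)
               * Gbinom (2 * of_nat n + 2 * of_real lam - 1) (2 * of_nat n - 1)
               * (of_nat n + (s + of_real lam) / 2 - 3 / 4 gchoose n))"
    by (rule q_even_eq_p[OF n np])
  show "q lam (2 * n) s =
            2 ^ (2 * n + 1) * p lam (2 * n) s
            / (pochhammer (2 * of_real lam) (2 * n)
               * (\<Prod>j=1..n. 2 * s + 2 * of_real lam + 4 * of_nat j - 3))"
    using q_eq_p[OF assms(1) _ np] n by (simp add: q_den_def)
next
  fix n s assume np: "no_pole lam (2 * n + 1) s"
  show "q lam (2 * n + 1) s =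
            p lam (2 * n + 1) s
            / (of_real lam * fact n * fact (2 * n)
               * Gbinom (2 * of_nat n + 2 * of_real lam) (2 * of_nat n)
               * (of_nat n + (s + of_real lam) / 2 - 1 / 4 gchoose n))"
    by (rule q_odd_eq_p[OF np])
  have "(2 * n + 1) div 2 = n" by simp
  thus "q lam (2 * n + 1) s =
            2 ^ (2 * n + 1) * p lam (2 * n + 1) s
            / (pochhammer (2 * of_real lam) (2 * n + 1)
               * (\<Prod>j=1..n. 2 * s + 2 * of_real lam + 4 * of_nat j - 1))"
    using q_eq_p[OF assms(1) _ np] by (simp add: q_den_def)
next
  fix n :: nat assume "1 \<le> n"
  thus "\<exists>N D :: complex poly.
          (\<forall>s. poly N s = 2 ^ (2 * (n div 2) + 1) * p lam n s)
        \<and> (\<forall>s. poly D s = pochhammer (2 * of_real lam) n * q_den lam n s)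
        \<and> (\<forall>s. no_pole lam n s \<longrightarrow> poly D s \<noteq> 0 \<and> q lam n s = poly N s / poly D s)
        \<and> coprime N D \<and> degree N = n div 2 \<and> degree D = n div 2"
    by (rule q_coprime_fraction[OF assms])
next
  fix n :: nat and s :: complex assume "0 < Re s"
  thus "no_pole lam n s" by (rule no_pole_right_half_plane[OF assms(1)])
next
  fix n :: nat assume "1 \<le> n"
  thus "q lam n holomorphic_on {s. Re s > 0}" by (rule q_holomorphic[OF assms])
next
  fix n :: nat and s assume n: "1 \<le> n" and "Re s = 1 / 2"
  hence "no_pole lam n s" by (intro no_pole_right_half_plane assms) simp
  thus "q lam n s = 0 \<longleftrightarrow> p lam n s = 0" by (rule q_eq_0_iff[OF assms n])
next
  fix n :: nat assume n: "1 \<le> n"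
  have "no_pole lam n (1 / 2 + \<i> * of_real t)" for t
    by (intro no_pole_right_half_plane assms) simp
  thus "{t::real. p lam n (1 / 2 + \<i> * of_real t) = 0} = {t::real. q lam n (1 / 2 + \<i> * of_real t) = 0}"
    using q_eq_0_iff[OF assms n] by blast
next
  fix n :: nat and x :: real assume "2 \<le> n" "1 < x"
  thus "q lam n (of_real x) \<in> complex_of_real ` {0<..<1}" by (intro q_real_bounds assms) auto
next
  fix n :: nat assume "2 \<le> n"
  thus "filterlim (\<lambda>x::real. Re (q lam n (of_real x))) (at_left 1) at_top"
    by (rule filterlim_q_at_left_1[OF assms])
next
  fix s show "q lam 1 s = 1" by (rule q_1[OF assms])
next
  fix n :: nat and s assume "1 \<le> n" "no_pole lam n s \<and> no_pole lam n (1 - s)"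
  thus "q lam n s =
            (-1) ^ (n div 2)
            * (of_nat (n div 2) + (1 - s + of_real lam + of_nat (eps n)) / 2 - 3 / 4
                 gchoose (n div 2))
            * inverse (of_nat (n div 2) + (s + of_real lam + of_nat (eps n)) / 2 - 3 / 4
                 gchoose (n div 2))
            * q lam n (1 - s)"
    using q_reflection[OF assms] by blast
qed

end
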